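(* Let $1\le t<N$ be integers. Consider quantum search on black-box inputs $x\in\{0,1\}^N$ under the promise that the number of solutions (indices $j$ with $x_j=1$) is at least $t$. Every quantum search algorithm that uses $T\leq N-t$ queries has error probability $$\varepsilon\in\Omega\left(e^{-4bT^2/(N-t)-8T\sqrt{tN/(N-t)^2}}\right),$$ where $b$ is a positive universal constant.
   Context: Quantum query model: the input $x=(x_0,\dots,x_{N-1})\in\{0,1\}^N$ is accessible only via the query gate $O:|j,b\rangle\mapsto|j,b\oplus x_j\rangle$. A $T$-query quantum algorithm is a unitary $U_TOU_{T-1}O\cdots OU_1OU_0$ applied to a fixed initial state $|\vec 0\rangle$, where the $U_i$ do not depend on $x$, followed by a measurement. A quantum search algorithm outputs an index $j$; its error probability is the maximum, over inputs satisfying the promise, of the probability that the output $j$ has $x_j=0$. The constant $b$ is the universal constant of the Coppersmith–Rivlin inequality: there are universal constants $a,b>0$ such that every real polynomial $p$ of degree $d$ with $|p(x)|\le 1$ for all integers $x\in[0,n]$ satisfies $|p(x)|<ae^{bd^2/n}$ for all real $x\in[0,n]$.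
   Formalization: The range T ≤ N−t is replaced by 1 ≤ T < N−t: with T = N−t queries the error can be 0 (query N−t indices; if none is a solution, any other is), and with T = 0 a random guess has error (N−t)/N, which is not bounded below by a constant. *)

theory Defs
  imports
    Complex_Main
    "HOL-Computational_Algebra.Polynomial"
    "Jordan_Normal_Form.Schur_Decomposition"
begin

section \<open>The Coppersmith--Rivlin inequality\<close>

text \<open>
  The restriction \<^term>\<open>degree p \<le> n\<close> is part of the inequality: without it every multiple of
  the polynomial with roots 0, ..., n would satisfy the hypothesis, and no constants
  could exist.
\<close>

definition coppersmith_rivlin :: "real \<Rightarrow> real \<Rightarrow> bool" where
  "coppersmith_rivlin a b \<longleftrightarrow> 0 < a \<and> 0 < b \<and>
     (\<forall>(p :: real poly) n.
        0 < n \<and> degree p \<le> n \<and> (\<forall>i\<le>n. \<bar>poly p (real i)\<bar> \<le> 1) \<longrightarrow>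
        (\<forall>x. 0 \<le> x \<and> x \<le> real n \<longrightarrow>
           \<bar>poly p x\<bar> < a * exp (b * (real (degree p))\<^sup>2 / real n)))"


section \<open>Quantum query algorithms\<close>

text \<open>
  The state space is spanned by the basis states (j, b, w), where j < N is the query index,
  b < 2 the answer bit and w < W the content of an arbitrary workspace.  The basis state
  (j, b, w) is the coordinate \<^term>\<open>basis_index W j b w\<close> of a space of dimension
  \<^term>\<open>query_dim N W\<close>.
\<close>

definition query_dim :: "nat \<Rightarrow> nat \<Rightarrow> nat" where
  "query_dim N W = N * 2 * W"

definition basis_index :: "nat \<Rightarrow> nat \<Rightarrow> nat \<Rightarrow> nat \<Rightarrow> nat" where
  "basis_index W j b w = (j * 2 + b) * W + w"

definition query_map :: "nat \<Rightarrow> bool list \<Rightarrow> nat \<Rightarrow> nat" where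
  "query_map W x k =
     (let j = k div W div 2; b = k div W mod 2; w = k mod W
      in basis_index W j ((b + of_bool (x ! j)) mod 2) w)"

definition query_gate :: "nat \<Rightarrow> nat \<Rightarrow> bool list \<Rightarrow> complex mat" where
  "query_gate N W x =
     mat (query_dim N W) (query_dim N W) (\<lambda>(r, k). if r = query_map W x k then 1 else 0)"

definition unitary_mat :: "nat \<Rightarrow> complex mat \<Rightarrow> bool" where
  "unitary_mat d U \<longleftrightarrow> U \<in> carrier_mat d d \<and> mat_adjoint U * U = 1\<^sub>m d \<and> U * mat_adjoint U = 1\<^sub>m d"

text \<open>
  General quantum measurement with outcomes 0, ..., N - 1, given by measurement operators
  satisfying the completeness relation; projective measurements are a special case.
\<close>

definition quantum_measurement :: "nat \<Rightarrow> nat \<Rightarrow> (nat \<Rightarrow> complex mat) \<Rightarrow> bool" where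
  "quantum_measurement d N M \<longleftrightarrow> (\<forall>j<N. M j \<in> carrier_mat d d) \<and>
     mat d d (\<lambda>rk. \<Sum>j<N. (mat_adjoint (M j) * M j) $$ rk) = 1\<^sub>m d"

record query_algorithm =
  workspace :: nat
  gate :: "nat \<Rightarrow> complex mat"
  measurement :: "nat \<Rightarrow> complex mat"

definition search_algorithm :: "nat \<Rightarrow> nat \<Rightarrow> query_algorithm \<Rightarrow> bool" where
  "search_algorithm N T A \<longleftrightarrow> 0 < workspace A \<and>
     (\<forall>i\<le>T. unitary_mat (query_dim N (workspace A)) (gate A i)) \<and>
     quantum_measurement (query_dim N (workspace A)) N (measurement A)"

fun query_state :: "nat \<Rightarrow> query_algorithm \<Rightarrow> bool list \<Rightarrow> nat \<Rightarrow> complex vec" where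
  "query_state N A x 0 = gate A 0 *\<^sub>v unit_vec (query_dim N (workspace A)) 0"
| "query_state N A x (Suc i) =
     gate A (Suc i) *\<^sub>v (query_gate N (workspace A) x *\<^sub>v query_state N A x i)"

definition norm_sq :: "complex vec \<Rightarrow> real" where
  "norm_sq v = (\<Sum>i<dim_vec v. (cmod (v $ i))\<^sup>2)"

definition output_prob :: "nat \<Rightarrow> nat \<Rightarrow> query_algorithm \<Rightarrow> bool list \<Rightarrow> nat \<Rightarrow> real" where
  "output_prob N T A x j = norm_sq (measurement A j *\<^sub>v query_state N A x T)"

definition solutions :: "bool list \<Rightarrow> nat set" where
  "solutions x = {j. j < length x \<and> x ! j}"

definition promise_inputs :: "nat \<Rightarrow> nat \<Rightarrow> bool list set" where
  "promise_inputs N t = {x. length x = N \<and> t \<le> card (solutions x)}"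

definition input_error :: "nat \<Rightarrow> nat \<Rightarrow> query_algorithm \<Rightarrow> bool list \<Rightarrow> real" where
  "input_error N T A x = (\<Sum>j\<in>{..<N} - solutions x. output_prob N T A x j)"

definition error_prob :: "nat \<Rightarrow> nat \<Rightarrow> nat \<Rightarrow> query_algorithm \<Rightarrow> real" where
  "error_prob N t T A = Max (input_error N T A ` promise_inputs N t)"


section \<open>Sanity checks\<close>

lemma basis_index_less:
  assumes "j < N" "b < 2" "w < W"
  shows "basis_index W j b w < query_dim N W"
proof -
  have "j * 2 + b + 1 \<le> N * 2" using assms by simp
  then have "(j * 2 + b + 1) * W \<le> N * 2 * W" by (rule mult_le_mono1)
  then show ?thesis using assms(3) by (simp add: basis_index_def query_dim_def algebra_simps)
qed

lemma query_map_basis_index: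
  assumes "b < 2" "w < W"
  shows "query_map W x (basis_index W j b w) = basis_index W j ((b + of_bool (x ! j)) mod 2) w"
proof -
  have "basis_index W j b w div W = j * 2 + b" "basis_index W j b w mod W = w"
    using assms(2) by (simp_all add: basis_index_def)
  moreover have "(j * 2 + b) div 2 = j" "(j * 2 + b) mod 2 = b"
    using assms(1) by simp_all
  ultimately show ?thesis by (simp add: query_map_def)
qed

lemma mult_mat_unit_vec:
  fixes A :: "'a :: semiring_1 mat"
  assumes "A \<in> carrier_mat n n" "i < n"
  shows "A *\<^sub>v unit_vec n i = col A i"
proof (rule eq_vecI)
  fix r assume "r < dim_vec (col A i)"
  then have r: "r < n" using assms by simp
  have "(A *\<^sub>v unit_vec n i) $ r = (\<Sum>k = 0..<n. row A r $ k * unit_vec n i $ k)"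
    using assms r by (simp add: scalar_prod_def)
  also have "\<dots> = (\<Sum>k = 0..<n. if k = i then A $$ (r, i) else 0)"
    using assms r by (intro sum.cong) auto
  finally show "(A *\<^sub>v unit_vec n i) $ r = col A i $ r"
    using assms r by simp
qed (use assms in auto)

lemma query_gate_basis:
  assumes "j < N" "b < 2" "w < W"
  shows "query_gate N W x *\<^sub>v unit_vec (query_dim N W) (basis_index W j b w) =
    unit_vec (query_dim N W) (basis_index W j ((b + of_bool (x ! j)) mod 2) w)"
proof -
  note less = basis_index_less[OF assms]
  have "query_gate N W x *\<^sub>v unit_vec (query_dim N W) (basis_index W j b w) =
    col (query_gate N W x) (basis_index W j b w)"
    by (rule mult_mat_unit_vec) (use less in \<open>auto simp: query_gate_def\<close>)
  also have "\<dots> = unit_vec (query_dim N W) (basis_index W j ((b + of_bool (x ! j)) mod 2) w)"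
    by (rule eq_vecI)
       (use less basis_index_less[of j N "(b + of_bool (x ! j)) mod 2" w W] assms in
         \<open>auto simp: query_gate_def query_map_basis_index\<close>)
  finally show ?thesis .
qed

lemma finite_promise_inputs: "finite (promise_inputs N t)"
proof (rule finite_subset)
  show "promise_inputs N t \<subseteq> {x. set x \<subseteq> UNIV \<and> length x = N}"
    by (auto simp: promise_inputs_def)
  show "finite {x :: bool list. set x \<subseteq> UNIV \<and> length x = N}"
    by (rule finite_lists_length_eq) simp
qed

lemma promise_inputs_nonempty:
  assumes "t \<le> N"
  shows "promise_inputs N t \<noteq> {}"
proof -
  have "solutions (replicate N True) = {..<N}" by (auto simp: solutions_def)
  then have "replicate N True \<in> promise_inputs N t" using assms by (simp add: promise_inputs_def)
  then show ?thesis by blast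
qed

lemma card_nonsolutions:
  assumes "x \<in> promise_inputs N t"
  shows "card ({..<N} - solutions x) \<le> N - t"
proof -
  have "solutions x \<subseteq> {..<N}" "t \<le> card (solutions x)"
    using assms by (auto simp: promise_inputs_def solutions_def)
  then show ?thesis by (simp add: card_Diff_subset finite_subset)
qed


section \<open>The two extreme numbers of queries\<close>

text \<open>
  No bound of the form c * exp (...) with a universal constant c > 0 can hold for all
  T in {0..N - t}.  With T = N - t queries the error can be 0 (query N - t
  indices; if none of them is a solution, every other index is one), and with T = 0, where
  the exponent vanishes, the error can be (N - t) / N, which is not bounded away from 0.
  Both are shown here for t = N - 1 and arbitrarily large N.
\<close>

lemma mat_adjoint_index:
  assumes "A \<in> carrier_mat d d" "r < d" "k < d"
  shows "mat_adjoint A $$ (r, k) = conjugate (A $$ (k, r))"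
  using assms by (auto simp: mat_adjoint_def mat_of_rows_index)

definition diag_of :: "nat \<Rightarrow> (nat \<Rightarrow> real) \<Rightarrow> complex mat" where
  "diag_of d f = mat d d (\<lambda>(r, k). if r = k then complex_of_real (f r) else 0)"

lemma diag_of_carrier [simp]: "diag_of d f \<in> carrier_mat d d"
  by (simp add: diag_of_def)

lemma mat_adjoint_diag_of [simp]: "mat_adjoint (diag_of d f) = diag_of d f"
proof (rule eq_matI)
  fix r k assume "r < dim_row (diag_of d f)" "k < dim_col (diag_of d f)"
  then show "mat_adjoint (diag_of d f) $$ (r, k) = diag_of d f $$ (r, k)"
    by (subst mat_adjoint_index[of _ d]) (auto simp: diag_of_def)
qed (auto simp: mat_adjoint_def diag_of_def)

lemma diag_of_mult: "diag_of d f * diag_of d g = diag_of d (\<lambda>i. f i * g i)"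
proof (rule eq_matI)
  fix r k assume "r < dim_row (diag_of d (\<lambda>i. f i * g i))"
    "k < dim_col (diag_of d (\<lambda>i. f i * g i))"
  then have rk: "r < d" "k < d" by (auto simp: diag_of_def)
  have "(diag_of d f * diag_of d g) $$ (r, k) =
    (\<Sum>i = 0..<d. (if r = i then complex_of_real (f r) else 0) *
       (if i = k then complex_of_real (g i) else 0))"
    using rk by (simp add: diag_of_def scalar_prod_def)
  also have "\<dots> = (\<Sum>i = 0..<d. if i = r then
      (if r = k then complex_of_real (f r * g r) else 0) else 0)"
    by (intro sum.cong) auto
  finally show "(diag_of d f * diag_of d g) $$ (r, k) = diag_of d (\<lambda>i. f i * g i) $$ (r, k)"
    using rk by (simp add: diag_of_def)
qed (auto simp: diag_of_def)

lemma quantum_measurement_diag_of: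
  assumes "\<And>i. i < d \<Longrightarrow> (\<Sum>j<N. (f j i)\<^sup>2) = 1"
  shows "quantum_measurement d N (\<lambda>j. diag_of d (f j))"
  unfolding quantum_measurement_def
proof (intro conjI allI impI)
  show "mat d d (\<lambda>rk. \<Sum>j<N. (mat_adjoint (diag_of d (f j)) * diag_of d (f j)) $$ rk) = 1\<^sub>m d"
  proof (rule eq_matI)
    fix r k assume "r < dim_row (1\<^sub>m d :: complex mat)" "k < dim_col (1\<^sub>m d :: complex mat)"
    moreover have "(\<Sum>j<N. complex_of_real (f j r) * complex_of_real (f j r)) = 1" if "r < d"
      using arg_cong[OF assms[OF that], of complex_of_real] by (simp add: power2_eq_square)
    ultimately show "mat d d (\<lambda>rk. \<Sum>j<N. (mat_adjoint (diag_of d (f j)) * diag_of d (f j)) $$ rk)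
        $$ (r, k) = 1\<^sub>m d $$ (r, k)"
      by (simp add: diag_of_mult) (auto simp: diag_of_def)
  qed auto
qed simp

lemma unitary_mat_one: "unitary_mat d (1\<^sub>m d)"
proof -
  have "1\<^sub>m d = diag_of d (\<lambda>_. 1)" by (auto simp: diag_of_def)
  then show ?thesis by (simp add: unitary_mat_def diag_of_mult)
qed

lemma norm_sq_diag_of_unit_vec:
  assumes "i < d"
  shows "norm_sq (diag_of d f *\<^sub>v unit_vec d i) = (f i)\<^sup>2"
proof -
  have "diag_of d f *\<^sub>v unit_vec d i = col (diag_of d f) i"
    by (rule mult_mat_unit_vec) (use assms in auto)
  then have "norm_sq (diag_of d f *\<^sub>v unit_vec d i) =
    (\<Sum>r<d. (cmod (diag_of d f $$ (r, i)))\<^sup>2)"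
    using assms by (simp add: norm_sq_def diag_of_def)
  also have "\<dots> = (\<Sum>r<d. if r = i then (f i)\<^sup>2 else 0)"
    using assms by (intro sum.cong) (auto simp: diag_of_def)
  finally have "norm_sq (diag_of d f *\<^sub>v unit_vec d i) =
    (\<Sum>r<d. if r = i then (f i)\<^sup>2 else 0)" .
  then show ?thesis using assms by simp
qed

definition diag_algorithm :: "nat \<Rightarrow> (nat \<Rightarrow> nat \<Rightarrow> real) \<Rightarrow> query_algorithm" where
  "diag_algorithm N f = \<lparr>workspace = 1, gate = (\<lambda>_. 1\<^sub>m (query_dim N 1)),
     measurement = (\<lambda>j. diag_of (query_dim N 1) (f j))\<rparr>"

lemma search_algorithm_diag:
  assumes "\<And>i. i < 2 * N \<Longrightarrow> (\<Sum>j<N. (f j i)\<^sup>2) = 1"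
  shows "search_algorithm N T (diag_algorithm N f)"
  unfolding search_algorithm_def diag_algorithm_def
  using assms by (auto simp: unitary_mat_one query_dim_def intro!: quantum_measurement_diag_of)

lemma exact_search_with_N_minus_t_queries:
  assumes "2 \<le> N"
  shows "\<exists>A. search_algorithm N (N - (N - 1)) A \<and> error_prob N (N - 1) (N - (N - 1)) A = 0"
proof (intro exI conjI)
  define f :: "nat \<Rightarrow> nat \<Rightarrow> real" where
    "f j i = (if j = 0 \<and> i \<noteq> 0 \<or> j = 1 \<and> i = 0 then 1 else 0)" for j i
  let ?A = "diag_algorithm N f" and ?d = "query_dim N 1"
  have sum_f: "(\<Sum>j<N. (f j i)\<^sup>2) = 1" for i
  proof -
    have "(\<Sum>j<N. (f j i)\<^sup>2) = (\<Sum>j<N. if j = (if i = 0 then 1 else 0) then 1 else 0)"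
      by (intro sum.cong) (auto simp: f_def)
    also have "\<dots> = 1" using assms by (subst sum.delta) auto
    finally show ?thesis .
  qed
  then show "search_algorithm N (N - (N - 1)) ?A" by (rule search_algorithm_diag)
  have T: "N - (N - 1) = Suc 0" using assms by simp
  have err: "input_error N (Suc 0) ?A x = 0" if x: "x \<in> promise_inputs N (N - 1)" for x
    unfolding input_error_def
  proof (rule sum.neutral, rule ballI)
    fix j assume j: "j \<in> {..<N} - solutions x"
    let ?i = "of_bool (x ! 0) :: nat"
    have d: "?i < ?d" "0 < ?d" using assms by (auto simp: query_dim_def)
    have U: "1\<^sub>m ?d *\<^sub>v unit_vec ?d k = (unit_vec ?d k :: complex vec)" for k
      by (rule one_mult_mat_vec) simp
    have "query_state N ?A x (Suc 0) = unit_vec ?d ?i"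
      using query_gate_basis[of 0 N 0 0 1 x] assms
      by (auto simp: diag_algorithm_def U basis_index_def)
    then have "output_prob N (Suc 0) ?A x j = (f j ?i)\<^sup>2"
      unfolding output_prob_def
      using norm_sq_diag_of_unit_vec[OF d(1), of "f j"]
      by (simp only: diag_algorithm_def query_algorithm.simps)
    moreover have "f j ?i = 0"
    proof (rule ccontr)
      assume "f j ?i \<noteq> 0"
      then have "j = 0 \<and> x ! 0 \<or> j = 1 \<and> \<not> x ! 0" by (auto simp: f_def split: if_splits)
      moreover have "length x = N" using x by (simp add: promise_inputs_def)
      ultimately have "{0, 1} \<subseteq> {..<N} - solutions x"
        using j assms by (auto simp: solutions_def)
      then have "card {0, 1 :: nat} \<le> card ({..<N} - solutions x)" by (intro card_mono) auto
      then show False using card_nonsolutions[OF x] assms by simp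
    qed
    ultimately show "output_prob N (Suc 0) ?A x j = 0" by simp
  qed
  have "input_error N (Suc 0) ?A ` promise_inputs N (N - 1) = {0}"
    using err promise_inputs_nonempty[of "N - 1" N] by force
  then show "error_prob N (N - 1) (N - (N - 1)) ?A = 0"
    unfolding T error_prob_def by simp
qed

lemma search_without_queries:
  assumes "2 \<le> N"
  shows "\<exists>A. search_algorithm N 0 A \<and> error_prob N (N - 1) 0 A \<le> 1 / real N"
proof (intro exI conjI)
  define f :: "nat \<Rightarrow> nat \<Rightarrow> real" where "f j i = 1 / sqrt (real N)" for j i
  let ?A = "diag_algorithm N f" and ?d = "query_dim N 1"
  show "search_algorithm N 0 ?A"
    by (rule search_algorithm_diag) (use assms in \<open>simp add: f_def power_divide\<close>)
  have err: "input_error N 0 ?A x \<le> 1 / real N" if x: "x \<in> promise_inputs N (N - 1)" for x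
  proof -
    have d: "0 < ?d" using assms by (simp add: query_dim_def)
    have U: "1\<^sub>m ?d *\<^sub>v unit_vec ?d 0 = (unit_vec ?d 0 :: complex vec)"
      by (rule one_mult_mat_vec) simp
    have "output_prob N 0 ?A x j = 1 / real N" for j
      unfolding output_prob_def
      using norm_sq_diag_of_unit_vec[OF d, of "f j"] U[unfolded One_nat_def]
      by (simp add: diag_algorithm_def) (simp add: f_def power_divide)
    then have "input_error N 0 ?A x = real (card ({..<N} - solutions x)) / real N"
      by (simp add: input_error_def)
    moreover have "card ({..<N} - solutions x) \<le> 1"
      using card_nonsolutions[OF x] assms by simp
    ultimately show ?thesis by (simp add: divide_right_mono)
  qed
  show "error_prob N (N - 1) 0 ?A \<le> 1 / real N"
    unfolding error_prob_def
    using err finite_promise_inputs promise_inputs_nonempty[of "N - 1" N]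
    by (subst Max_le_iff) auto
qed

corollary no_bound_including_N_minus_t:
  assumes "0 < c"
  shows "\<not> (\<forall>N\<ge>N0. \<forall>t T A. 1 \<le> t \<and> t < N \<and> 1 \<le> T \<and> T \<le> N - t \<and> search_algorithm N T A \<longrightarrow>
    error_prob N t T A \<ge> c * exp (g N t T))"
proof
  assume *: "\<forall>N\<ge>N0. \<forall>t T A. 1 \<le> t \<and> t < N \<and> 1 \<le> T \<and> T \<le> N - t \<and>
    search_algorithm N T A \<longrightarrow> error_prob N t T A \<ge> c * exp (g N t T)"
  define N where "N = max 2 N0"
  then have N: "2 \<le> N" "N0 \<le> N" by auto
  obtain A where A: "search_algorithm N (N - (N - 1)) A"
      "error_prob N (N - 1) (N - (N - 1)) A = 0"
    using exact_search_with_N_minus_t_queries[OF N(1)] by blast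
  have "c * exp (g N (N - 1) (N - (N - 1))) \<le> error_prob N (N - 1) (N - (N - 1)) A"
    using *[rule_format, of N "N - 1" "N - (N - 1)" A] A(1) N by simp
  moreover have "0 < c * exp (g N (N - 1) (N - (N - 1)))" using assms by simp
  ultimately show False using A(2) by simp
qed

corollary no_bound_without_queries:
  assumes "0 < c"
  shows "\<not> (\<forall>N\<ge>N0. \<forall>t A. 1 \<le> t \<and> t < N \<and> search_algorithm N 0 A \<longrightarrow> error_prob N t 0 A \<ge> c)"
proof
  assume *: "\<forall>N\<ge>N0. \<forall>t A. 1 \<le> t \<and> t < N \<and> search_algorithm N 0 A \<longrightarrow> error_prob N t 0 A \<ge> c"
  obtain K :: nat where K: "1 / c < real K" using reals_Archimedean2 by blast
  define N where "N = Max {2, N0, K}"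
  then have N: "2 \<le> N" "N0 \<le> N" "K \<le> N" by auto
  obtain A where A: "search_algorithm N 0 A" "error_prob N (N - 1) 0 A \<le> 1 / real N"
    using search_without_queries[OF N(1)] by blast
  have "c \<le> error_prob N (N - 1) 0 A" using *[rule_format, of N "N - 1" A] A(1) N by simp
  with A(2) have "c \<le> 1 / real N" by simp
  moreover have "1 / c < real N" using K N(3) by linarith
  ultimately show False using assms N(1) by (simp add: field_simps)
qed

end

theory Submission
  imports "HOL-Complex_Analysis.Conformal_Mappings" Defs
begin

unbundle no vec_syntax

text \<open>
  The error of an algorithm is bounded from below through a polynomial linear in its amplitudes
  rather than quadratic. With \<open>\<psi> j x\<close> the unnormalised state after outcome \<open>j\<close> on input \<open>x\<close>,
  \<open>g x = (\<Sum>j. (1 - x j) * \<langle>\<psi> j 0, \<psi> j x\<rangle>)\<close> is a multilinear polynomial of degree at most \<open>T + 1\<close>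
  with \<open>g 0 = 1\<close> and \<open>\<bar>g x\<bar> \<le> sqrt (error on x)\<close>. Symmetrising over inputs of equal Hamming weight
  gives a univariate polynomial that is 1 at 0 and at most \<open>sqrt \<epsilon>\<close> at \<open>t, ..., N\<close>. Since
  \<open>T + 1 \<le> N - t\<close>, the Coppersmith--Rivlin inequality bounds it on the whole interval
  \<open>[t, N]\<close>, and extrapolation to 0 costs a factor \<open>exp (2 (T + 1) sqrt (t / (N - t)))\<close>.

  For the Coppersmith--Rivlin inequality, put \<open>x = n (1 + cos \<theta>) / 2\<close>. By Bernstein's inequality a
  polynomial of degree \<open>d\<close> attaining its maximum where \<open>sin \<theta> \<ge> C d / n\<close> is comparable to
  its maximum at the integers, because the integers are then \<open>1 / d\<close>-dense in \<open>\<theta>\<close>. To force the maximum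
  there, one multiplies by the \<open>k\<close>-th power, \<open>k \<approx> d\<^sup>2 / n\<close>, of a polynomial of degree \<open>n / d\<close>
  that is small for \<open>sin \<theta> \<le> C d / n\<close> and of order 1 elsewhere.
\<close>

lemma poly_of_real_poly: "poly (map_poly of_real p) (of_real x :: complex) = of_real (poly p x)"
  by (induction p) (auto simp: map_poly_pCons)

lemma degree_of_real_poly: "degree (map_poly of_real p :: complex poly) = degree p"
  by (simp add: degree_map_poly)

section \<open>Growth of bounded polynomials\<close>

text \<open>The Joukowski map sends the unit circle to [-1, 1], so
  \<open>w ^ d * poly p ((w + inverse w) / 2)\<close> is bounded by \<open>M\<close> on the circle
  and, by the maximum principle, in the disc. Exchanging \<open>w\<close> and
  \<open>inverse w\<close> covers the outside.\<close>

lemma bernstein_walsh: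
  fixes p :: "complex poly"
  assumes deg: "degree p \<le> d" and bd: "\<And>x::real. \<bar>x\<bar> \<le> 1 \<Longrightarrow> norm (poly p (of_real x)) \<le> M"
    and w: "w \<noteq> 0"
  shows "norm (poly p ((w + inverse w) / 2)) \<le> M * max (norm w) (norm (inverse w)) ^ d"
proof -
  \<comment> \<open>Only nonnegative powers of \<open>w\<close> occur here, so \<open>g\<close> is
    holomorphic at 0 as well.\<close>
  define g where "g = (\<lambda>w. \<Sum>i\<le>d. coeff p i * ((w\<^sup>2 + 1) / 2) ^ i * w ^ (d - i))"
  have g: "g w = w ^ d * poly p ((w + inverse w) / 2)" if "w \<noteq> 0" for w
  proof -
    have "poly p y = (\<Sum>i\<le>d. coeff p i * y ^ i)" for y
      unfolding poly_altdef using deg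
      by (intro sum.mono_neutral_left) (auto simp: coeff_eq_0)
    moreover have "((w\<^sup>2 + 1) / 2) ^ i * w ^ (d - i) = w ^ d * ((w + inverse w) / 2) ^ i"
      if "i \<le> d" for i
    proof -
      have "(w\<^sup>2 + 1) / 2 = w * ((w + inverse w) / 2)"
        using \<open>w \<noteq> 0\<close> by (simp add: field_simps power2_eq_square)
      moreover have "w ^ d = w ^ i * w ^ (d - i)" using that by (simp flip: power_add)
      ultimately show ?thesis by (simp only: power_mult_distrib mult_ac)
    qed
    ultimately show ?thesis
      by (auto simp: g_def sum_distrib_left mult_ac intro!: sum.cong)
  qed
  have M: "0 \<le> M" using bd[of 0] order_trans[OF norm_ge_zero] by fastforce
  have circle: "norm (g w) \<le> M" if "norm w = 1" for w
  proof -
    have "w \<noteq> 0" using that by auto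
    have "inverse w = cnj w" using that by (simp add: complex_eq_iff flip: cmod_power2)
    then have "(w + inverse w) / 2 = of_real (Re w)" by (simp add: complex_add_cnj)
    moreover have "\<bar>Re w\<bar> \<le> 1" using abs_Re_le_cmod[of w] that by simp
    ultimately show ?thesis using g[OF \<open>w \<noteq> 0\<close>] bd[of "Re w"] that
      by (simp add: norm_mult norm_power)
  qed
  have disc: "norm (g w) \<le> M" if "norm w \<le> 1" for w
  proof (rule maximum_modulus_frontier[where f = g and S = "cball 0 1"])
    show "g holomorphic_on interior (cball 0 1)"
      unfolding g_def by (intro holomorphic_intros) auto
    show "continuous_on (closure (cball 0 1)) g"
      unfolding g_def by (intro continuous_intros) auto
    show "norm (g z) \<le> M" if "z \<in> frontier (cball 0 1)" for z
      using that circle by (simp add: frontier_cball sphere_def)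
  qed (use that in auto)
  have small: "norm (poly p ((w + inverse w) / 2)) \<le> M * norm (inverse w) ^ d"
    if "w \<noteq> 0" "norm w \<le> 1" for w
  proof -
    have "norm w ^ d * norm (poly p ((w + inverse w) / 2)) \<le> M"
      using disc[OF that(2)] g[OF that(1)] by (simp add: norm_mult norm_power)
    then have "norm (poly p ((w + inverse w) / 2)) \<le> M / norm w ^ d"
      using that(1) by (subst pos_le_divide_eq) (auto simp: mult.commute)
    then show ?thesis by (simp only: norm_inverse power_inverse divide_inverse)
  qed
  show ?thesis
  proof (cases "norm w \<le> 1")
    case True
    have "norm (poly p ((w + inverse w) / 2)) \<le> M * norm (inverse w) ^ d" by (rule small[OF w True])
    also have "\<dots> \<le> M * max (norm w) (norm (inverse w)) ^ d"
      using M by (intro mult_left_mono power_mono) auto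
    finally show ?thesis .
  next
    case False
    have "norm (poly p ((inverse w + inverse (inverse w)) / 2)) \<le> M * norm (inverse (inverse w)) ^ d"
      by (rule small) (use False w in \<open>auto simp: norm_inverse inverse_le_1_iff\<close>)
    also have "\<dots> \<le> M * max (norm w) (norm (inverse w)) ^ d"
      using M by (intro mult_left_mono power_mono) auto
    finally show ?thesis by (simp add: add.commute)
  qed
qed

text \<open>Its use is the estimate \<open>arcosh (1 + \<mu>)\<close> \<le>
  \<open>sqrt (2 * \<mu>)\<close>, which sets the growth rate just outside the interval.\<close>

lemma cosh_ge_quadratic:
  assumes "0 \<le> (s::real)"
  shows "1 + s\<^sup>2 / 2 \<le> cosh s"
proof -
  have sinh: "x \<le> sinh x" if "0 \<le> x" for x :: real
    using DERIV_nonneg_imp_nondecreasing[of 0 x "\<lambda>x. sinh x - x"] that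
    by (force intro!: derivative_eq_intros simp: cosh_real_ge_1)
  show ?thesis
    using DERIV_nonneg_imp_nondecreasing[of 0 s "\<lambda>x. cosh x - x\<^sup>2 / 2"] assms
    by (force intro!: derivative_eq_intros simp: sinh)
qed

text \<open>For \<open>z = cosh s\<close> beyond 1, \<open>bernstein_walsh\<close> at
  \<open>w = exp s\<close> gives the growth factor \<open>exp (d * s)\<close>, and \<open>s\<close>
  is at most \<open>sqrt (2 * \<mu>)\<close>.\<close>

lemma poly_extrapolate:
  fixes p :: "real poly"
  assumes deg: "degree p \<le> d" and bd: "\<And>x. \<bar>x\<bar> \<le> 1 \<Longrightarrow> \<bar>poly p x\<bar> \<le> M"
    and y: "\<bar>y\<bar> \<le> 1 + \<mu>" and \<mu>: "0 \<le> \<mu>"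
  shows "\<bar>poly p y\<bar> \<le> M * exp (real d * sqrt (2 * \<mu>))"
proof -
  have M: "0 \<le> M" using bd[of 0] by simp
  have pos: "\<bar>poly q z\<bar> \<le> M * exp (real d * sqrt (2 * \<mu>))"
    if q: "degree q \<le> d" "\<And>x. \<bar>x\<bar> \<le> 1 \<Longrightarrow> \<bar>poly q x\<bar> \<le> M" and z: "1 \<le> z" "z \<le> 1 + \<mu>" for q z
  proof -
    define s where "s = arcosh z"
    have s: "cosh s = z" "0 \<le> s" using z by (simp_all add: s_def)
    have "s\<^sup>2 \<le> 2 * \<mu>" using cosh_ge_quadratic[of s] s z by simp
    then have s_le: "s \<le> sqrt (2 * \<mu>)" by (rule real_le_rsqrt)
    have "norm (poly (map_poly of_real q :: complex poly)
        ((of_real (exp s) + inverse (of_real (exp s))) / 2)) \<le>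
      M * max (norm (of_real (exp s) :: complex)) (norm (inverse (of_real (exp s)) :: complex)) ^ d"
      by (rule bernstein_walsh)
         (use q in \<open>auto simp: degree_of_real_poly poly_of_real_poly simp del: of_real_exp\<close>)
    moreover have "(of_real (exp s) + inverse (of_real (exp s))) / 2 = (of_real z :: complex)"
      using s(1) by (simp add: s(1)[symmetric] cosh_field_def exp_minus)
    moreover have "max (norm (of_real (exp s) :: complex)) (norm (inverse (of_real (exp s)) :: complex)) = exp s"
    proof -
      have "inverse (exp s) \<le> exp s" using s(2) by (simp flip: exp_minus)
      then show ?thesis by (simp add: norm_inverse del: of_real_exp)
    qed
    ultimately have "\<bar>poly q z\<bar> \<le> M * exp s ^ d"
      by (simp add: poly_of_real_poly)
    also have "exp s ^ d = exp (real d * s)" by (simp add: exp_of_nat_mult)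
    also have "M * \<dots> \<le> M * exp (real d * sqrt (2 * \<mu>))"
      using M s_le by (intro mult_left_mono) (auto intro!: mult_left_mono)
    finally show ?thesis .
  qed
  consider "\<bar>y\<bar> \<le> 1" | "1 \<le> y" | "1 \<le> - y" by linarith
  then show ?thesis
  proof cases
    case 1
    have "M * 1 \<le> M * exp (real d * sqrt (2 * \<mu>))"
      using M \<mu> by (intro mult_left_mono) auto
    then show ?thesis using bd[OF 1] by simp
  next
    case 2
    then show ?thesis using pos[of p y] deg bd y by simp
  next
    case 3
    then show ?thesis using pos[of "p \<circ>\<^sub>p [:0, -1:]" "-y"] deg bd y
      by (simp add: poly_pcompose degree_pcompose)
  qed
qed

text \<open>The function \<open>poly p (cos z)\<close> is entire of exponential type
  \<open>d\<close>, by \<open>bernstein_walsh\<close> at \<open>w = exp (\<i> * z)\<close>. Cauchy's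
  estimate on circles of radius \<open>1 / d\<close> bounds its derivative, losing a factor
  \<open>exp 1\<close> against Bernstein's sharp constant.\<close>

lemma bernstein_cos:
  fixes p :: "real poly"
  assumes deg: "degree p \<le> d" and d: "0 < d" and bd: "\<And>x. \<bar>x\<bar> \<le> 1 \<Longrightarrow> \<bar>poly p x\<bar> \<le> M"
  shows "\<bar>poly p (cos \<theta>) - poly p (cos \<phi>)\<bar> \<le> exp 1 * real d * M * \<bar>\<theta> - \<phi>\<bar>"
proof -
  have M: "0 \<le> M" using bd[of 0] by simp
  define P :: "complex poly" where "P = map_poly of_real p"
  define F where "F = (\<lambda>z. poly P (cos z))"
  have hol: "F holomorphic_on A" for A
    unfolding F_def by (intro holomorphic_intros) 
  have growth: "norm (F z) \<le> M * exp (real d * \<bar>Im z\<bar>)" for z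
  proof -
    have "norm (poly P ((exp (\<i> * z) + inverse (exp (\<i> * z))) / 2)) \<le>
      M * max (norm (exp (\<i> * z))) (norm (inverse (exp (\<i> * z)))) ^ d"
      by (rule bernstein_walsh)
         (use assms in \<open>auto simp: P_def degree_of_real_poly poly_of_real_poly\<close>)
    moreover have "(exp (\<i> * z) + inverse (exp (\<i> * z))) / 2 = cos z"
      by (simp add: cos_exp_eq exp_minus)
    moreover have "max (norm (exp (\<i> * z))) (norm (inverse (exp (\<i> * z)))) = exp \<bar>Im z\<bar>"
      unfolding norm_inverse norm_exp_eq_Re exp_minus[symmetric] by (simp add: max_def)
    ultimately show ?thesis by (simp add: F_def exp_of_nat_mult)
  qed
  have "norm (deriv F (of_real x)) \<le> exp 1 * real d * M" for x :: real
  proof -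
    have "norm ((deriv ^^ 1) F (of_real x)) \<le> fact 1 * (M * exp 1) / (1 / real d) ^ 1"
    proof (rule Cauchy_inequality)
      fix z assume "norm (complex_of_real x - z) = 1 / real d"
      then have "\<bar>Im z\<bar> \<le> 1 / real d" using abs_Im_le_cmod[of "complex_of_real x - z"] by simp
      then have "real d * \<bar>Im z\<bar> \<le> 1" using d by (simp add: field_simps)
      then have "M * exp (real d * \<bar>Im z\<bar>) \<le> M * exp 1" using M by (intro mult_left_mono) auto
      with growth[of z] show "norm (F z) \<le> M * exp 1" by linarith
    qed (use d hol in \<open>auto intro: holomorphic_on_imp_continuous_on\<close>)
    then show ?thesis by (simp add: mult_ac)
  qed
  then have "norm (F (of_real \<theta>) - F (of_real \<phi>)) \<le>
      exp 1 * real d * M * norm (complex_of_real \<theta> - of_real \<phi>)"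
    by (intro field_differentiable_bound[OF convex_Reals, where f' = "deriv F"])
       (auto elim!: Reals_cases intro: has_field_derivative_at_within holomorphic_derivI[OF hol[of UNIV]])
  moreover have "F (of_real x) = of_real (poly p (cos x))" for x
    by (simp add: F_def P_def cos_of_real poly_of_real_poly)
  ultimately show ?thesis
    by (simp del: of_real_diff add: norm_of_real flip: of_real_diff)
qed

section \<open>Polynomials bounded at equally spaced points\<close>

fun cheb :: "nat \<Rightarrow> real poly" where
  "cheb 0 = 1"
| "cheb (Suc 0) = [:0, 1:]"
| "cheb (Suc (Suc n)) = [:0, 2:] * cheb (Suc n) - cheb n"

lemma degree_cheb: "degree (cheb n) \<le> n"
proof (induction n rule: cheb.induct)
  case (3 n)
  have "degree ([:0, 2:] * cheb (Suc n)) \<le> Suc (Suc n)"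
    using degree_mult_le[of "[:0, 2:]" "cheb (Suc n)"] 3 by simp
  then show ?case using 3 by (auto intro: degree_diff_le)
qed auto

lemma poly_cheb_cos: "poly (cheb n) (cos \<theta>) = cos (real n * \<theta>)"
proof (induction n rule: cheb.induct)
  case (3 n)
  have "cos (real (Suc (Suc n)) * \<theta>) + cos (real n * \<theta>) = 2 * cos \<theta> * cos (real (Suc n) * \<theta>)"
    using cos_add[of "real (Suc n) * \<theta>" \<theta>] cos_diff[of "real (Suc n) * \<theta>" \<theta>]
    by (simp add: algebra_simps)
  then show ?case using 3 by simp
qed auto

lemma abs_sin_mult_le: "\<bar>sin (real j * \<theta>)\<bar> \<le> real j * \<bar>sin \<theta>\<bar>"
proof (induction j)
  case (Suc j)
  have "\<bar>sin (real (Suc j) * \<theta>)\<bar> = \<bar>sin (real j * \<theta>) * cos \<theta> + cos (real j * \<theta>) * sin \<theta>\<bar>"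
    using sin_add[of "real j * \<theta>" \<theta>] by (simp add: algebra_simps)
  also have "\<dots> \<le> \<bar>sin (real j * \<theta>)\<bar> * 1 + 1 * \<bar>sin \<theta>\<bar>"
    unfolding abs_mult[symmetric]
    by (rule order_trans[OF abs_triangle_ineq], unfold abs_mult, intro add_mono mult_mono) auto
  also have "\<dots> \<le> real (Suc j) * \<bar>sin \<theta>\<bar>" using Suc by (simp add: distrib_right)
  finally show ?case .
qed simp

text \<open>
  In the variable \<open>cos \<theta>\<close> this is the average of \<open>2 sin\<^sup>2 (j \<theta>)\<close> over \<open>j = 1, ..., r\<close>: a function of size 1
  except for dips of width \<open>1 / r\<close> at both end points.
\<close>

definition dip :: "nat \<Rightarrow> real poly" where
  "dip r = Polynomial.smult (2 / real r) (\<Sum>j=1..r. 1 - (cheb j)\<^sup>2)"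

lemma degree_dip: "degree (dip r) \<le> 2 * r"
proof -
  have "degree (1 - (cheb j)\<^sup>2) \<le> 2 * r" if "j \<in> {1..r}" for j
    using degree_power_le[of "cheb j" 2] degree_cheb[of j] that
    by (intro degree_diff_le) auto
  then have "degree (\<Sum>j=1..r. 1 - (cheb j)\<^sup>2) \<le> 2 * r" by (intro degree_sum_le) auto
  then show ?thesis unfolding dip_def by (rule order_trans[OF degree_smult_le])
qed

lemma poly_dip_cos: "poly (dip r) (cos \<theta>) = 2 / real r * (\<Sum>j=1..r. (sin (real j * \<theta>))\<^sup>2)"
  unfolding dip_def poly_smult poly_sum poly_diff poly_power poly_cheb_cos poly_1 sin_squared_eq ..

lemma dip_nonneg: "0 \<le> poly (dip r) (cos \<theta>)"
  unfolding poly_dip_cos by (intro mult_nonneg_nonneg sum_nonneg) auto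

lemma dip_le_2: "poly (dip r) (cos \<theta>) \<le> 2"
proof (cases "r = 0")
  case False
  have "(\<Sum>j=1..r. (sin (real j * \<theta>))\<^sup>2) \<le> of_nat (card {1..r}) * 1"
    by (rule sum_bounded_above) (simp add: abs_square_le_1)
  then have "poly (dip r) (cos \<theta>) \<le> 2 / real r * (of_nat (card {1..r}) * 1)"
    unfolding poly_dip_cos by (rule mult_left_mono) simp
  then show ?thesis using False by simp
qed (simp add: dip_def)

text \<open>This measures the depth of the dip: each sine in the average is at most
  \<open>r * \<bar>sin \<theta>\<bar>\<close>.\<close>

lemma dip_le: "poly (dip r) (cos \<theta>) \<le> 2 * (real r)\<^sup>2 * (sin \<theta>)\<^sup>2"
proof (cases "r = 0")
  case False
  have "(sin (real j * \<theta>))\<^sup>2 \<le> (real r)\<^sup>2 * (sin \<theta>)\<^sup>2" if "j \<in> {1..r}" for j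
  proof -
    have "\<bar>sin (real j * \<theta>)\<bar> \<le> real r * \<bar>sin \<theta>\<bar>"
      using that by (intro order_trans[OF abs_sin_mult_le] mult_right_mono) auto
    then have "\<bar>sin (real j * \<theta>)\<bar>\<^sup>2 \<le> (real r * \<bar>sin \<theta>\<bar>)\<^sup>2" by (intro power_mono) auto
    then show ?thesis by (simp add: power_mult_distrib)
  qed
  then have "(\<Sum>j=1..r. (sin (real j * \<theta>))\<^sup>2) \<le> of_nat (card {1..r}) * ((real r)\<^sup>2 * (sin \<theta>)\<^sup>2)"
    by (rule sum_bounded_above)
  then have "poly (dip r) (cos \<theta>) \<le> 2 / real r * (of_nat (card {1..r}) * ((real r)\<^sup>2 * (sin \<theta>)\<^sup>2))"
    unfolding poly_dip_cos by (rule mult_left_mono) simp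
  then show ?thesis using False by simp
qed (simp add: dip_def)

text \<open>Multiplication by \<open>2 * sin \<theta>\<close> makes the sum telescope. Divided by
  \<open>r\<close>, the cosine sum is the amount by which \<open>dip\<close> falls below 1.\<close>

lemma dirichlet_kernel:
  "2 * sin \<theta> * (\<Sum>j=1..r. cos (2 * real j * \<theta>)) = sin ((2 * real r + 1) * \<theta>) - sin \<theta>"
proof (induction r)
  case (Suc r)
  have "sin ((2 * real (Suc r) + 1) * \<theta>) - sin ((2 * real r + 1) * \<theta>) =
    2 * sin \<theta> * cos (2 * real (Suc r) * \<theta>)"
    using sin_add[of "2 * real (Suc r) * \<theta>" \<theta>] sin_diff[of "2 * real (Suc r) * \<theta>" \<theta>]
    by (simp add: algebra_simps)
  then show ?case using Suc by (simp add: distrib_left)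
qed simp

text \<open>The double-angle formula turns the average into 1 minus a Dirichlet kernel over
  \<open>r\<close>, and that kernel is at most \<open>1 / sin \<theta>\<close>.\<close>

lemma dip_ge:
  assumes "0 < r" and s: "0 < sin \<theta>"
  shows "1 - 1 / (real r * sin \<theta>) \<le> poly (dip r) (cos \<theta>)"
proof -
  define C where "C = (\<Sum>j=1..r. cos (2 * real j * \<theta>))"
  have "(sin (real j * \<theta>))\<^sup>2 = (1 - cos (2 * real j * \<theta>)) / 2" for j
    using cos_double_sin[of "real j * \<theta>"] by (simp add: mult.assoc)
  then have "poly (dip r) (cos \<theta>) = 1 / real r * (\<Sum>j=1..r. 1 - cos (2 * real j * \<theta>))"
    by (simp only: poly_dip_cos flip: sum_divide_distrib) simp
  also have "\<dots> = 1 - C / real r"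
    using assms by (simp add: sum_subtractf C_def field_simps)
  finally have dip: "poly (dip r) (cos \<theta>) = 1 - C / real r" .
  have "2 * (sin \<theta> * C) \<le> 2"
    using dirichlet_kernel[of \<theta> r] sin_le_one[of "(2 * real r + 1) * \<theta>"] s
    unfolding C_def by linarith
  then have "C \<le> 1 / sin \<theta>" using s by (simp add: field_simps)
  then have "C / real r \<le> 1 / sin \<theta> / real r" by (rule divide_right_mono) simp
  then show ?thesis using dip by (simp add: mult.commute)
qed

section \<open>From the grid points to the whole interval\<close>

lemma half_le_sin:
  assumes "0 \<le> h" "h \<le> (1::real)"
  shows "h / 2 \<le> sin h"
proof -
  have "cos x \<ge> 1 / 2" if "0 \<le> x" "x \<le> h" for x
  proof -
    have "cos (pi / 3) \<le> cos x"
      using that assms pi_gt3 by (intro cos_monotone_0_pi_le) auto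
    then show ?thesis by (simp add: cos_60)
  qed
  then show ?thesis
    using DERIV_nonneg_imp_nondecreasing[of 0 h "\<lambda>x. sin x - x / 2"] assms
    by (force intro!: derivative_eq_intros)
qed

text \<open>
  The window \<open>[\<theta> - h, \<theta> + h]\<close> in which Bernstein's inequality keeps \<open>R\<close> above half its maximum
  is mapped by \<open>cos\<close> to an interval of length \<open>2 sin \<theta> sin h \<ge> 2 / n\<close>.
\<close>

lemma grid_max:
  fixes R :: "real poly"
  assumes deg: "degree R \<le> \<Delta>" and \<Delta>: "0 < \<Delta>" and n: "0 < n"
    and bd: "\<And>x. \<bar>x\<bar> \<le> 1 \<Longrightarrow> \<bar>poly R x\<bar> \<le> \<bar>poly R (cos \<theta>)\<bar>"
    and sin: "12 * real \<Delta> \<le> real n * sin \<theta>"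
  shows "\<exists>i\<le>n. \<bar>poly R (cos \<theta>)\<bar> \<le> 2 * \<bar>poly R (2 * real i / real n - 1)\<bar>"
proof -
  \<comment> \<open>This width makes the change allowed by \<open>bernstein_cos\<close> exactly half
    of the maximum.\<close>
  define h where "h = 1 / (2 * exp 1 * real \<Delta>)"
  have e: "1 \<le> exp (1::real)" "exp (1::real) \<le> 3" using exp_le by auto
  have "1 * 1 \<le> exp 1 * real \<Delta>" using e \<Delta> by (intro mult_mono) auto
  then have h: "0 < h" "h \<le> 1" unfolding h_def using \<Delta> by (auto simp: field_simps)
  \<comment> \<open>\<open>exp 1\<close> \<le> 3 and \<open>sin h\<close> \<ge> \<open>h / 2\<close>
    produce the constant 12 of the hypothesis on \<open>sin \<theta>\<close>.\<close>
  have "1 / (6 * real \<Delta>) \<le> h" unfolding h_def using \<Delta> e by (intro divide_left_mono) auto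
  then have h': "1 / (12 * real \<Delta>) \<le> sin h" using half_le_sin[of h] h by simp
  have s0: "0 < sin \<theta>" 
  proof -
    have "0 < real n * sin \<theta>" using sin \<Delta> by (intro less_le_trans[OF _ sin]) simp
    then show ?thesis using n by (simp add: zero_less_mult_iff)
  qed
  define a b where "a = cos (\<theta> + h)" and "b = cos (\<theta> - h)"
  have "b - a = 2 * sin \<theta> * sin h" by (simp add: a_def b_def cos_add cos_diff)
  moreover have "12 * real \<Delta> / real n * (1 / (12 * real \<Delta>)) \<le> sin \<theta> * sin h"
    using sin n \<Delta> h' s0 by (intro mult_mono) (auto simp: field_simps)
  ultimately have ab: "a + 2 / real n \<le> b" using \<Delta> by simp
  have ab1: "-1 \<le> a" "b \<le> 1" by (auto simp: a_def b_def)
  \<comment> \<open>The grid \<open>2 * i / n - 1\<close> has spacing \<open>2 / n\<close>, so its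
    first point at or right of \<open>a\<close> is still at most \<open>b\<close>.\<close>
  define i where "i = nat \<lceil>real n * (1 + a) / 2\<rceil>"
  have "0 \<le> real n * (1 + a) / 2" using ab1 by simp
  then have i: "real n * (1 + a) / 2 \<le> real i" "real i < real n * (1 + a) / 2 + 1"
    unfolding i_def by linarith+
  define X where "X = 2 * real i / real n - 1"
  have X: "a \<le> X" "X \<le> b" using i n ab by (simp_all add: X_def field_simps)
  have "2 * real i / real n \<le> 2" using X ab1 by (simp add: X_def)
  then have "real i \<le> real n" using n by (simp add: pos_divide_le_eq)
  then have "i \<le> n" by simp
  obtain \<phi> where \<phi>: "\<theta> - h \<le> \<phi>" "\<phi> \<le> \<theta> + h" "cos \<phi> = X"
    using IVT2'[of cos "\<theta> + h" X "\<theta> - h"] X h continuous_on_cos[OF continuous_on_id]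
    by (auto simp: a_def b_def)
  define M where "M = \<bar>poly R (cos \<theta>)\<bar>"
  have "\<bar>poly R (cos \<theta>) - poly R (cos \<phi>)\<bar> \<le> exp 1 * real \<Delta> * M * \<bar>\<theta> - \<phi>\<bar>"
    unfolding M_def by (rule bernstein_cos) (use assms in auto)
  also have "\<dots> \<le> exp 1 * real \<Delta> * M * h"
    using \<phi> by (intro mult_left_mono) (auto simp: M_def)
  also have "\<dots> = M / 2" using \<Delta> by (simp add: h_def)
  finally have "M \<le> 2 * \<bar>poly R X\<bar>" using \<phi>(3) unfolding M_def by (simp add: abs_if split: if_splits)
  then show ?thesis using \<open>i \<le> n\<close> by (auto simp: M_def X_def)
qed

text \<open>Rescaling the inner interval of half-length \<open>\<xi>\<close> to [-1, 1] moves 1 to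
  \<open>1 / \<xi>\<close>, which is at most \<open>1 + 2 * \<sigma>\<^sup>2\<close>. So
  \<open>poly_extrapolate\<close> applies with \<open>\<mu> = 2 * \<sigma>\<^sup>2\<close>.\<close>

lemma poly_extrapolate_inner:
  fixes P :: "real poly"
  assumes deg: "degree P \<le> d" and \<sigma>: "0 \<le> \<sigma>" "\<sigma> \<le> 1/2"
    and bd: "\<And>x. x\<^sup>2 \<le> 1 - \<sigma>\<^sup>2 \<Longrightarrow> \<bar>poly P x\<bar> \<le> B" and y: "\<bar>y\<bar> \<le> 1"
  shows "\<bar>poly P y\<bar> \<le> B * exp (2 * real d * \<sigma>)"
proof -
  define \<xi> where "\<xi> = sqrt (1 - \<sigma>\<^sup>2)"
  have "\<sigma>\<^sup>2 \<le> (1/2)\<^sup>2" using \<sigma> by (intro power_mono) auto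
  then have s2: "\<sigma>\<^sup>2 \<le> 1/4" by (simp add: power2_eq_square)
  then have \<xi>2: "\<xi>\<^sup>2 = 1 - \<sigma>\<^sup>2" by (simp add: \<xi>_def)
  have \<xi>1: "\<xi> \<le> 1" by (simp add: \<xi>_def)
  have "1/2 \<le> \<xi>" unfolding \<xi>_def using s2 by (intro real_le_rsqrt) (simp add: power2_eq_square)
  have "\<xi>\<^sup>2 \<le> \<xi>" using \<xi>1 \<open>1/2 \<le> \<xi>\<close> by (simp add: power2_eq_square mult_le_cancel_left1)
  have "\<bar>poly (P \<circ>\<^sub>p [:0, \<xi>:]) (y / \<xi>)\<bar> \<le> B * exp (real d * sqrt (2 * (2 * \<sigma>\<^sup>2)))"
  proof (rule poly_extrapolate)
    show "degree (P \<circ>\<^sub>p [:0, \<xi>:]) \<le> d"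
      using deg degree_pcompose_le[of P "[:0, \<xi>:]"] \<open>1/2 \<le> \<xi>\<close> by (auto simp: degree_pcompose)
    show "\<bar>poly (P \<circ>\<^sub>p [:0, \<xi>:]) x\<bar> \<le> B" if "\<bar>x\<bar> \<le> 1" for x
    proof -
      have "(x * \<xi>)\<^sup>2 \<le> 1 * \<xi>\<^sup>2" unfolding power_mult_distrib
        using that by (intro mult_right_mono) (auto simp: abs_square_le_1)
      then show ?thesis using bd[of "x * \<xi>"] \<xi>2 by (simp add: poly_pcompose)
    qed
    have "1 \<le> (1 + 2 * \<sigma>\<^sup>2) * \<xi>"
    proof -
      have "1 - \<xi> \<le> \<sigma>\<^sup>2" using \<xi>2 \<open>\<xi>\<^sup>2 \<le> \<xi>\<close> by simp
      also have "\<sigma>\<^sup>2 * 1 \<le> \<sigma>\<^sup>2 * (2 * \<xi>)" using \<open>1/2 \<le> \<xi>\<close> by (intro mult_left_mono) auto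
      finally show ?thesis by (simp add: algebra_simps)
    qed
    then show "\<bar>y / \<xi>\<bar> \<le> 1 + 2 * \<sigma>\<^sup>2" using y \<open>1/2 \<le> \<xi>\<close> by (simp add: pos_divide_le_eq)
  qed auto
  moreover have "sqrt (2 * (2 * \<sigma>\<^sup>2)) = 2 * \<sigma>"
    using \<sigma> by (simp add: real_sqrt_mult)
  ultimately show ?thesis using \<open>1/2 \<le> \<xi>\<close> by (simp add: poly_pcompose mult_ac)
qed

text \<open>The grid controls maxima only away from the end points. The factor
  \<open>dip r ^ k\<close> keeps the maximum out of the region \<open>sin \<theta>\<close> <
  \<open>\<tau>\<close>; this bounds \<open>P\<close> where \<open>sin \<theta>\<close> \<ge>
  \<open>\<sigma>\<close>, and \<open>poly_extrapolate_inner\<close> covers the rest. As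
  \<open>n\<close> \<le> \<open>D\<^sup>2\<close>, the exponent unit \<open>E\<close> is at least 1
  and absorbs rounding.\<close>

lemma bounded_on_grid_imp_bounded:
  fixes P :: "real poly"
  assumes deg: "degree P \<le> D" and D: "0 < D" "n \<le> D\<^sup>2" "4032 * D \<le> n"
    and grid: "\<And>i. i \<le> n \<Longrightarrow> \<bar>poly P (2 * real i / real n - 1)\<bar> \<le> 1"
    and x: "\<bar>x\<bar> \<le> 1"
  shows "\<bar>poly P x\<bar> \<le> exp (12099 * (real D)\<^sup>2 / real n)"
proof -
  have n: "0 < n" using D by simp
  \<comment> \<open>\<open>grid_max\<close> at degree \<open>14 * D\<close> needs
    \<open>sin \<theta>\<close> \<ge> \<open>12 * 14 * D / n\<close>, which is
    \<open>\<tau>\<close>. The larger \<open>\<sigma>\<close> is \<open>12 * \<tau>\<close>, and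
    \<open>4032 * D\<close> \<le> \<open>n\<close> says that \<open>\<sigma>\<close> \<le>
    1/2.\<close>
  define \<sigma> where "\<sigma> = 2016 * real D / real n"
  define \<tau> where "\<tau> = 168 * real D / real n"
  \<comment> \<open>\<open>r * \<sigma>\<close> lies between 2 and 3, so \<open>dip r\<close> is at
    least 1/2 where the sine is at least \<open>\<sigma>\<close> and at most 1/8 where it is below
    \<open>\<tau>\<close>. The choice of \<open>k\<close> gives
    \<open>exp (2 * D * \<sigma>)\<close> \<le> \<open>exp k\<close>.\<close>
  define r where "r = nat \<lceil>2 / \<sigma>\<rceil>"
  define k where "k = nat \<lceil>2 * real D * \<sigma>\<rceil>"
  define E where "E = (real D)\<^sup>2 / real n"
  have rD: "4032 * real D \<le> real n" using D(3) by (metis of_nat_le_iff of_nat_mult of_nat_numeral)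
  have \<sigma>: "0 < \<sigma>" "\<sigma> \<le> 1/2" unfolding \<sigma>_def using n D rD by (auto simp: field_simps)
  have \<sigma>\<tau>: "\<sigma> = 12 * \<tau>" by (simp add: \<sigma>_def \<tau>_def)
  have "0 \<le> 2 / \<sigma>" using \<sigma> by simp
  then have "2 / \<sigma> \<le> real r" "real r \<le> 2 / \<sigma> + 1" unfolding r_def by linarith+
  then have r: "2 \<le> real r * \<sigma>" "real r * \<sigma> \<le> 3" using \<sigma> by (simp_all add: field_simps)
  then have r0: "0 < r" by (cases r) auto
  have "(real n) \<le> (real D)\<^sup>2" using D(2) by (metis of_nat_le_iff of_nat_power)
  then have E1: "1 \<le> E" using n by (simp add: E_def field_simps)
  have D\<sigma>: "real D * \<sigma> = 2016 * E" by (simp add: \<sigma>_def E_def power2_eq_square)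
  have "0 \<le> 2 * real D * \<sigma>" using \<sigma> by simp
  then have k: "2 * real D * \<sigma> \<le> real k" "real k \<le> 2 * real D * \<sigma> + 1" unfolding k_def by linarith+
  have k0: "0 < k" using k(1) D\<sigma> E1 by (intro gr0I) (simp add: mult.commute[of \<sigma>])
  \<comment> \<open>The dips add degree \<open>12 * D\<close> up to rounding, and one more
    \<open>D\<close> pays for rounding \<open>k\<close> up.\<close>
  have rk: "D + 2 * r * k \<le> 14 * D"
  proof -
    have "\<sigma> * (2 * real r * real k) = 2 * (real r * \<sigma>) * real k" by simp
    also have "\<dots> \<le> 6 * real k" using r by (intro mult_right_mono) linarith+
    also have "\<dots> \<le> 12 * (real D * \<sigma>) + 6" using k by simp
    also have "6 \<le> \<sigma> * real D" using D\<sigma> E1 by (simp add: mult.commute)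
    finally have "\<sigma> * (2 * real r * real k) \<le> \<sigma> * (13 * real D)" by (simp add: algebra_simps)
    then have "2 * real r * real k \<le> 13 * real D" using \<sigma> by simp
    then have "real (2 * r * k) \<le> real (13 * D)" by simp
    then show ?thesis by linarith
  qed
  \<comment> \<open>\<open>S\<close> consists of the values \<open>cos \<phi>\<close> with
    \<open>\<bar>sin \<phi>\<bar>\<close> \<ge> \<open>\<sigma>\<close>.\<close>
  define S where "S = {x :: real. x\<^sup>2 \<le> 1 - \<sigma>\<^sup>2}"
  have S1: "\<bar>x\<bar> \<le> 1" if "x \<in> S" for x
    using that by (simp add: S_def abs_square_le_1[symmetric]) (smt (verit) zero_le_power2)
  have "closed S" unfolding S_def by (intro closed_Collect_le continuous_intros)
  moreover have "bounded S" using S1 by (auto simp: bounded_iff)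
  ultimately have "compact S" by (simp add: compact_eq_bounded_closed)
  moreover have "0 \<in> S" using \<sigma> by (simp add: S_def abs_square_le_1)
  ultimately have "\<exists>x\<in>S. \<forall>y\<in>S. \<bar>poly P y\<bar> \<le> \<bar>poly P x\<bar>"
    by (intro continuous_attains_sup) (auto intro!: continuous_intros)
  then obtain x1 where x1: "x1 \<in> S" "\<And>y. y \<in> S \<Longrightarrow> \<bar>poly P y\<bar> \<le> \<bar>poly P x1\<bar>"
    by blast
  define B where "B = \<bar>poly P x1\<bar>"
  have outer: "\<bar>poly P y\<bar> \<le> B * exp (2 * real D * \<sigma>)" if "\<bar>y\<bar> \<le> 1" for y
    by (rule poly_extrapolate_inner) (use deg \<sigma> x1(2) that in \<open>auto simp: S_def B_def\<close>)
  \<comment> \<open>\<open>B / 2 ^ k\<close> is at most the maximum of \<open>\<bar>R\<bar>\<close>,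
    hence at most twice a grid value of \<open>\<bar>R\<bar>\<close>, hence at most
    \<open>2 * 2 ^ k\<close>: the dip is at least 1/2 at \<open>x1\<close> and at most 2
    everywhere.\<close>
  have B: "B \<le> 2 * 4 ^ k"
  proof (cases "B = 0")
    case False
    define R where "R = P * dip r ^ k"
    have "degree R \<le> D + 2 * r * k"
      unfolding R_def using deg degree_dip[of r] degree_power_le[of "dip r" k]
      by (meson add_mono degree_mult_le mult_le_mono1 order_trans)
    then have degR: "degree R \<le> 14 * D" using rk by linarith
    obtain x0 where x0: "\<bar>x0\<bar> \<le> 1" "\<And>y. \<bar>y\<bar> \<le> 1 \<Longrightarrow> \<bar>poly R y\<bar> \<le> \<bar>poly R x0\<bar>"
    proof -
      have "\<exists>x\<in>{-1..1}. \<forall>y\<in>{-1..1}. \<bar>poly R y\<bar> \<le> \<bar>poly R x\<bar>"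
        by (intro continuous_attains_sup) (auto intro!: continuous_intros)
      then show ?thesis using that by (auto simp: abs_le_iff)
    qed
    define \<theta> where "\<theta> = arccos x0"
    have \<theta>: "cos \<theta> = x0" "0 \<le> sin \<theta>"
      using x0(1) arccos_bounded[of x0] by (auto simp: \<theta>_def intro!: sin_ge_zero)
    have half: "1 / 2 \<le> poly (dip r) x1"
    proof -
      define \<phi> where "\<phi> = arccos x1"
      have \<phi>: "cos \<phi> = x1" "0 \<le> sin \<phi>"
        using S1[OF x1(1)] arccos_bounded[of x1] by (auto simp: \<phi>_def intro!: sin_ge_zero)
      have "\<sigma>\<^sup>2 \<le> (sin \<phi>)\<^sup>2" using x1(1) by (simp add: S_def sin_squared_eq \<phi>)
      then have "\<sigma> \<le> sin \<phi>" using \<phi>(2) by (rule power2_le_imp_le)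
      then have "real r * \<sigma> \<le> real r * sin \<phi>" by (intro mult_left_mono) auto
      then have "1 / (real r * sin \<phi>) \<le> 1 / 2" using r by (intro divide_left_mono) auto
      then show ?thesis using dip_ge[OF r0, of \<phi>] \<open>\<sigma> \<le> sin \<phi>\<close> \<sigma> \<phi>(1) by simp
    qed
    have B_le: "B * (1 / 2) ^ k \<le> \<bar>poly R x0\<bar>"
    proof -
      have "B * (1 / 2) ^ k \<le> B * poly (dip r) x1 ^ k"
        using half by (intro mult_left_mono power_mono) (auto simp: B_def)
      also have "\<dots> = \<bar>poly R x1\<bar>" using half by (simp add: B_def R_def abs_mult power_abs)
      also have "\<dots> \<le> \<bar>poly R x0\<bar>" using x0(2) S1[OF x1(1)] by blast
      finally show ?thesis .
    qed
    \<comment> \<open>Near the end points extrapolation lets \<open>P\<close> gain at most \<open>exp (2 D \<sigma>) \<le> exp k\<close>,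
      while the \<open>k\<close>-th power of the dip loses \<open>4 ^ k\<close> against its value at \<open>x1\<close>.\<close>
    have "\<tau> \<le> sin \<theta>"
    proof (rule ccontr)
      assume "\<not> \<tau> \<le> sin \<theta>"
      then have "(sin \<theta>)\<^sup>2 \<le> \<tau>\<^sup>2" using \<theta>(2) by (intro power_mono) auto
      then have "2 * (real r)\<^sup>2 * (sin \<theta>)\<^sup>2 \<le> 2 * (real r)\<^sup>2 * \<tau>\<^sup>2" by (intro mult_left_mono) auto
      also have "\<dots> = 2 * (real r * \<sigma>)\<^sup>2 / 144" by (simp add: \<sigma>\<tau> power_mult_distrib)
      also have "(real r * \<sigma>)\<^sup>2 \<le> 3\<^sup>2" using r by (intro power_mono) auto
      finally have "poly (dip r) x0 \<le> 1 / 8" using dip_le[of r \<theta>] \<theta>(1) by simp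
      moreover have "0 \<le> poly (dip r) x0" using dip_nonneg[of r \<theta>] \<theta>(1) by simp
      ultimately have "\<bar>poly R x0\<bar> \<le> (B * exp (2 * real D * \<sigma>)) * (1 / 8) ^ k"
        using outer[OF x0(1)] by (auto simp: R_def abs_mult power_abs intro!: mult_mono power_mono)
      with B_le have "B * (1 / 2) ^ k \<le> B * (exp (2 * real D * \<sigma>) * (1 / 8) ^ k)" by (simp add: mult_ac)
      moreover have "0 < B" using False by (simp add: B_def)
      ultimately have "(1 / 2) ^ k \<le> exp (2 * real D * \<sigma>) * (1 / 8 :: real) ^ k" by simp
      then have "(1 / 2) ^ k * 8 ^ k \<le> exp (2 * real D * \<sigma>) * ((1 / 8) ^ k * 8 ^ k)"
        by (simp add: mult_right_mono flip: mult.assoc)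
      then have "4 ^ k \<le> exp (2 * real D * \<sigma>)" by (simp flip: power_mult_distrib)
      also have "\<dots> \<le> exp (real k)" using k by simp
      also have "\<dots> = exp 1 ^ k" by (simp flip: exp_of_nat_mult)
      also have "\<dots> < 4 ^ k" using exp_le k0 by (intro power_strict_mono) auto
      finally show False by simp
    qed
    then have "12 * real (14 * D) \<le> real n * sin \<theta>" using n by (simp add: \<tau>_def field_simps)
    then obtain i where i: "i \<le> n" "\<bar>poly R (cos \<theta>)\<bar> \<le> 2 * \<bar>poly R (2 * real i / real n - 1)\<bar>"
      using grid_max[OF degR _ n, of \<theta>] D x0 \<theta>(1) by auto
    define X where "X = 2 * real i / real n - 1"
    have "\<bar>X\<bar> \<le> 1" using i n by (auto simp: X_def abs_le_iff field_simps)
    then have "0 \<le> poly (dip r) X" "poly (dip r) X \<le> 2"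
      using dip_nonneg[of r "arccos X"] dip_le_2[of r "arccos X"] by simp_all
    then have "\<bar>poly R X\<bar> \<le> 1 * 2 ^ k"
      using grid[OF i(1)] unfolding R_def poly_mult poly_power abs_mult power_abs X_def[symmetric]
      by (intro mult_mono power_mono) auto
    then have "B * (1 / 2) ^ k \<le> 2 * 2 ^ k" using B_le i(2) \<theta>(1) by (simp add: X_def)
    then have "B * (1 / 2) ^ k * 2 ^ k \<le> 2 * 2 ^ k * 2 ^ k" by (rule mult_right_mono) simp
    then show ?thesis by (simp add: mult.assoc flip: power_mult_distrib)
  qed simp
  \<comment> \<open>In units of \<open>E\<close> the exponent collects 1 for the factor 2, 8066 for
    \<open>4 ^ k\<close> \<le> \<open>exp (2 * k)\<close>, and 4032 for the extrapolation: 12099 in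
    all.\<close>
  have "(4::real) ^ k \<le> exp 2 ^ k"
    using exp_ge_add_one_self[of "1::real"] mult_mono[of 2 "exp 1" 2 "exp (1::real)"]
    by (intro power_mono) (auto simp flip: exp_add)
  also have "\<dots> = exp (2 * real k)" by (simp add: mult.commute flip: exp_of_nat_mult)
  also have "\<dots> \<le> exp (8066 * E)" using k D\<sigma> E1 by simp
  finally have "4 ^ k \<le> exp (8066 * E)" .
  moreover have "2 \<le> exp E" using exp_ge_add_one_self[of E] E1 by linarith
  ultimately have "2 * 4 ^ k \<le> exp E * exp (8066 * E)" by (intro mult_mono) auto
  with B have "B \<le> exp E * exp (8066 * E)" by linarith
  then have "B * exp (2 * real D * \<sigma>) \<le> exp E * exp (8066 * E) * exp (4032 * E)"
    using D\<sigma> by (intro mult_mono) (simp_all add: mult.assoc)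
  also have "\<dots> = exp (12099 * E)" by (simp flip: exp_add)
  finally show ?thesis using outer[OF x] by (simp add: E_def)
qed

section \<open>A crude bound by Lagrange interpolation\<close>

lemma prod_abs_diff_eq_fact:
  assumes "i \<le> n"
  shows "(\<Prod>j\<in>{..n} - {i}. \<bar>real i - real j\<bar>) = fact i * fact (n - i)"
proof -
  have fact: "(\<Prod>j<m. real (Suc j)) = fact m" for m
    by (induction m) (auto simp: mult.commute)
  have split: "{..n} - {i} = {..<i} \<union> {i<..n}" using assms by auto
  have "(\<Prod>j\<in>{..n} - {i}. \<bar>real i - real j\<bar>) =
    (\<Prod>j<i. \<bar>real i - real j\<bar>) * (\<Prod>j\<in>{i<..n}. \<bar>real i - real j\<bar>)"
    unfolding split by (rule prod.union_disjoint) auto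
  also have "(\<Prod>j<i. \<bar>real i - real j\<bar>) = (\<Prod>j<i. real (Suc j))"
    by (rule prod.reindex_bij_witness[of _ "\<lambda>j. i - Suc j" "\<lambda>j. i - Suc j"]) auto
  also have "\<dots> = fact i" by (rule fact)
  also have "(\<Prod>j\<in>{i<..n}. \<bar>real i - real j\<bar>) = (\<Prod>j<n - i. real (Suc j))"
    by (rule prod.reindex_bij_witness[of _ "\<lambda>j. i + Suc j" "\<lambda>j. j - Suc i"]) auto
  also have "\<dots> = fact (n - i)" by (rule fact)
  finally show ?thesis .
qed

lemma lagrange_interpolation:
  fixes p :: "real poly"
  assumes "degree p \<le> n"
  shows "poly p x = (\<Sum>i\<le>n. poly p (real i) *
    (\<Prod>j\<in>{..n} - {i}. (x - real j) / (real i - real j)))"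
proof -
  define L where "L i = (\<Prod>j\<in>{..n} - {i}. Polynomial.smult (1 / (real i - real j)) [:- real j, 1:])" for i
  define q where "q = (\<Sum>i\<le>n. Polynomial.smult (poly p (real i)) (L i))"
  have L: "poly (L i) y = (\<Prod>j\<in>{..n} - {i}. (y - real j) / (real i - real j))" for i y
    by (simp add: L_def poly_prod diff_divide_distrib)
  have "degree (L i) \<le> n" if "i \<le> n" for i
  proof -
    have "degree (L i) \<le> (\<Sum>j\<in>{..n} - {i}. degree (Polynomial.smult (1 / (real i - real j)) [:- real j, 1:]))"
      unfolding L_def by (rule order_trans[OF degree_prod_sum_le]) (simp_all add: o_def)
    also have "\<dots> \<le> (\<Sum>j\<in>{..n} - {i}. 1)" by (intro sum_mono) simp
    finally show ?thesis using that by simp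
  qed
  then have "degree q \<le> n"
    unfolding q_def by (intro degree_sum_le) (auto intro: order_trans[OF degree_smult_le])
  moreover have "poly q (real k) = poly p (real k)" if "k \<le> n" for k
  proof -
    have "poly (L i) (real k) = (if i = k then 1 else 0)" if "i \<le> n" for i
      using that \<open>k \<le> n\<close> by (auto simp: L intro!: prod_zero prod.neutral bexI[of _ k])
    then have "poly q (real k) = (\<Sum>i\<le>n. if i = k then poly p (real k) else 0)"
      unfolding q_def poly_sum poly_smult by (intro sum.cong) auto
    then show ?thesis using that by simp
  qed
  ultimately have "q = p"
    using assms by (intro poly_eqI_degree[of "real ` {..n}"]) (auto simp: card_image)
  then have "poly p x = poly q x" by simp
  then show ?thesis by (simp add: q_def poly_sum L)
qed

text \<open>The left side over \<open>fact n\<close> is a single term of the series of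
  \<open>exp n\<close>.\<close>

lemma power_self_le_fact_exp: "real n ^ n \<le> fact n * exp (real n)"
proof -
  have "(\<Sum>k\<in>{n}. real n ^ k /\<^sub>R fact k) \<le> (\<Sum>k. real n ^ k /\<^sub>R fact k)"
    by (rule sum_le_suminf) (use summable_exp_generic[of "real n"] in auto)
  then show ?thesis by (simp add: exp_def field_simps)
qed

text \<open>Lagrange numerators are at most \<open>n ^ n\<close> \<le> \<open>fact n * exp n\<close>
  and the denominators are \<open>fact i * fact (n - i)\<close>, so the basis polynomials are
  bounded by \<open>exp n\<close> times binomial coefficients. This serves degrees comparable with
  \<open>n\<close>.\<close>

lemma bounded_at_integers_imp_exponential_bound:
  fixes p :: "real poly"
  assumes deg: "degree p \<le> n" and bd: "\<And>i. i \<le> n \<Longrightarrow> \<bar>poly p (real i)\<bar> \<le> 1"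
    and x: "0 \<le> x" "x \<le> real n"
  shows "\<bar>poly p x\<bar> \<le> exp (2 * real n)"
proof -
  have "\<bar>poly p x\<bar> \<le> (\<Sum>i\<le>n. \<bar>poly p (real i) *
    (\<Prod>j\<in>{..n} - {i}. (x - real j) / (real i - real j))\<bar>)"
    unfolding lagrange_interpolation[OF deg, of x] by (rule sum_abs)
  also have "\<dots> \<le> (\<Sum>i\<le>n. exp (real n) * real (n choose i))"
  proof (rule sum_mono)
    fix i assume "i \<in> {..n}"
    then have i: "i \<le> n" by simp
    have "\<bar>\<Prod>j\<in>{..n} - {i}. (x - real j) / (real i - real j)\<bar> =
      (\<Prod>j\<in>{..n} - {i}. \<bar>x - real j\<bar>) / (fact i * fact (n - i))"
      unfolding prod_abs_diff_eq_fact[OF i, symmetric] by (simp add: abs_prod prod_dividef)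
    also have "(\<Prod>j\<in>{..n} - {i}. \<bar>x - real j\<bar>) \<le> (\<Prod>j\<in>{..n} - {i}. real n)"
      using x by (intro prod_mono) auto
    also have "\<dots> = real n ^ n" using i by simp
    also have "\<dots> / (fact i * fact (n - i)) \<le> fact n * exp (real n) / (fact i * fact (n - i))"
      by (intro divide_right_mono power_self_le_fact_exp) simp
    also have "\<dots> = exp (real n) * real (n choose i)" using i by (simp add: binomial_fact)
    finally have le: "\<bar>\<Prod>j\<in>{..n} - {i}. (x - real j) / (real i - real j)\<bar> \<le> exp (real n) * real (n choose i)"
      by (simp add: divide_right_mono)
    show "\<bar>poly p (real i) * (\<Prod>j\<in>{..n} - {i}. (x - real j) / (real i - real j))\<bar> \<le>
        exp (real n) * real (n choose i)"
      using mult_mono[OF bd[OF i] le] by (simp add: abs_mult)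
  qed
  also have "\<dots> = exp (real n) * 2 ^ n"
    by (simp add: choose_row_sum flip: sum_distrib_left of_nat_sum)
  also have "\<dots> \<le> exp (real n) * exp 1 ^ n"
    using exp_ge_add_one_self[of "1::real"] by (intro mult_left_mono power_mono) auto
  also have "\<dots> = exp (2 * real n)" by (simp flip: exp_of_nat_mult exp_add)
  finally show ?thesis .
qed

text \<open>For \<open>D\<close> small against \<open>n\<close> an affine substitution leads to the
  grid on [-1, 1]. Otherwise \<open>n\<close> < \<open>4032 * D\<close>, and the crude exponent
  \<open>2 * n\<close> is at most \<open>2 * 4032\<^sup>2 * D\<^sup>2 / n\<close>; this is the
  origin of the constant.\<close>

lemma coppersmith_rivlin_of_square_ge:
  fixes p :: "real poly"
  assumes deg: "degree p \<le> D" "degree p \<le> n" and n: "0 < n" "n \<le> D\<^sup>2"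
    and bd: "\<And>i. i \<le> n \<Longrightarrow> \<bar>poly p (real i)\<bar> \<le> 1"
    and x: "0 \<le> x" "x \<le> real n"
  shows "\<bar>poly p x\<bar> \<le> exp (32514048 * (real D)\<^sup>2 / real n)"
proof (cases "4032 * D \<le> n")
  case True
  define P where "P = p \<circ>\<^sub>p [:real n / 2, real n / 2:]"
  have P: "poly P y = poly p (real n * (1 + y) / 2)" for y
    by (simp add: P_def poly_pcompose field_simps)
  have "\<bar>poly P (2 * x / real n - 1)\<bar> \<le> exp (12099 * (real D)\<^sup>2 / real n)"
  proof (rule bounded_on_grid_imp_bounded[OF _ _ n(2) True])
    show "degree P \<le> D" using deg by (simp add: P_def)
    show "0 < D" using n by (cases D) auto
    show "\<bar>2 * x / real n - 1\<bar> \<le> 1" using x n by (auto simp: abs_le_iff field_simps)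
  qed (use bd n in \<open>auto simp: P\<close>)
  also have "\<dots> \<le> exp (32514048 * (real D)\<^sup>2 / real n)"
    by (simp add: divide_right_mono)
  finally show ?thesis using n by (simp add: P)
next
  case False
  then have "real n \<le> 4032 * real D" by simp
  then have "(real n)\<^sup>2 \<le> (4032 * real D)\<^sup>2" by (intro power_mono) auto
  then have "2 * real n \<le> 32514048 * (real D)\<^sup>2 / real n"
    using n by (simp add: power_mult_distrib pos_le_divide_eq power2_eq_square)
  then have "exp (2 * real n) \<le> exp (32514048 * (real D)\<^sup>2 / real n)" by simp
  then show ?thesis
    using bounded_at_integers_imp_exponential_bound[OF deg(2) bd x] by linarith
qed

theorem ex_coppersmith_rivlin: "\<exists>a b. coppersmith_rivlin a b"
proof -
  let ?b = "32514048 :: real"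
  \<comment> \<open>The term \<open>4 * n\<close> in the bound for \<open>D\<^sup>2\<close> below
    becomes \<open>exp (4 * ?b)\<close>; the factor 2 makes the inequality strict.\<close>
  have "\<bar>poly p x\<bar> < 2 * exp (4 * ?b) * exp (?b * (real (degree p))\<^sup>2 / real n)"
    if n: "0 < n" and deg: "degree p \<le> n" and bd: "\<forall>i\<le>n. \<bar>poly p (real i)\<bar> \<le> 1"
      and x: "0 \<le> x" "x \<le> real n" for p n x
  proof -
    \<comment> \<open>Raising the degree bound to \<open>sqrt n\<close> only costs a constant factor.\<close>
    define s where "s = nat \<lceil>sqrt (real n)\<rceil>"
    define D where "D = max (degree p) s"
    have s: "sqrt (real n) \<le> real s" "real s \<le> sqrt (real n) + 1"
      unfolding s_def by (simp_all add: of_nat_ceiling)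
    have "real n = (sqrt (real n))\<^sup>2" by simp
    also have "\<dots> \<le> (real D)\<^sup>2" using s by (intro power_mono) (auto simp: D_def)
    finally have "real n \<le> real (D\<^sup>2)" by simp
    then have nD: "n \<le> D\<^sup>2" by (simp only: of_nat_le_iff)
    have "1 \<le> sqrt (real n)" using n by simp
    then have "real s \<le> 2 * sqrt (real n)" using s(2) by linarith
    then have "(real s)\<^sup>2 \<le> (2 * sqrt (real n))\<^sup>2" by (intro power_mono) auto
    then have "(real D)\<^sup>2 \<le> (real (degree p))\<^sup>2 + 4 * real n"
      by (auto simp: D_def max_def power_mult_distrib intro: add_increasing)
    then have "?b * (real D)\<^sup>2 / real n \<le> ?b * ((real (degree p))\<^sup>2 + 4 * real n) / real n"
      by (intro divide_right_mono mult_left_mono) auto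
    also have "\<dots> = 4 * ?b + ?b * (real (degree p))\<^sup>2 / real n" using n by (simp add: field_simps)
    finally have "exp (?b * (real D)\<^sup>2 / real n) \<le> exp (4 * ?b) * exp (?b * (real (degree p))\<^sup>2 / real n)"
      by (simp flip: exp_add)
    moreover have "\<bar>poly p x\<bar> \<le> exp (?b * (real D)\<^sup>2 / real n)"
      by (rule coppersmith_rivlin_of_square_ge) (use deg n nD bd x in \<open>auto simp: D_def\<close>)
    moreover have "0 < exp (4 * ?b) * exp (?b * (real (degree p))\<^sup>2 / real n)" by simp
    ultimately show ?thesis by linarith
  qed
  then have "coppersmith_rivlin (2 * exp (4 * ?b)) ?b"
    unfolding coppersmith_rivlin_def by auto
  then show ?thesis by blast
qed

section \<open>Symmetrisation of multilinear polynomials\<close>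

text \<open>Polynomials are represented by the functions they define on bit strings: on bits, the
  product of the variables in \<open>S\<close> is the indicator of \<open>S\<close> \<subseteq>
  \<open>solutions x\<close>. Values are constrained only on lists of length
  \<open>N\<close>.\<close>

inductive multilinear_poly :: "nat \<Rightarrow> nat \<Rightarrow> (bool list \<Rightarrow> complex) \<Rightarrow> bool" for N where
  monom: "S \<subseteq> {..<N} \<Longrightarrow> card S \<le> d \<Longrightarrow>
    (\<And>x. length x = N \<Longrightarrow> f x = c * of_bool (S \<subseteq> solutions x)) \<Longrightarrow> multilinear_poly N d f"
| add: "multilinear_poly N d f \<Longrightarrow> multilinear_poly N d g \<Longrightarrow>
    (\<And>x. length x = N \<Longrightarrow> h x = f x + g x) \<Longrightarrow> multilinear_poly N d h"

lemma multilinear_poly_mono: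
  "multilinear_poly N d f \<Longrightarrow> d \<le> e \<Longrightarrow> multilinear_poly N e f"
proof (induction rule: multilinear_poly.induct)
  case (monom S d f c)
  then show ?case by (intro multilinear_poly.monom[of S _ _ _ c]) auto
next
  case (add d f g h)
  show ?case by (rule multilinear_poly.add[OF add.IH(1,2)]) (use add in auto)
qed

lemma multilinear_poly_const: "multilinear_poly N d (\<lambda>_. c)"
  by (rule multilinear_poly.monom[of "{}" _ _ _ c]) auto

lemma multilinear_poly_cmult:
  "multilinear_poly N d f \<Longrightarrow> multilinear_poly N d (\<lambda>x. c * f x)"
proof (induction rule: multilinear_poly.induct)
  case (monom S d f c')
  then show ?case by (intro multilinear_poly.monom[of S _ _ _ "c * c'"]) auto
next
  case (add d f g h)
  show ?case by (rule multilinear_poly.add[OF add.IH]) (simp add: add.hyps distrib_left)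
qed

lemma multilinear_poly_add:
  "multilinear_poly N d f \<Longrightarrow> multilinear_poly N d g \<Longrightarrow> multilinear_poly N d (\<lambda>x. f x + g x)"
  by (rule multilinear_poly.add) auto

lemma multilinear_poly_sum:
  "(\<And>i. i \<in> A \<Longrightarrow> multilinear_poly N d (f i)) \<Longrightarrow> multilinear_poly N d (\<lambda>x. \<Sum>i\<in>A. f i x)"
  by (induction A rule: infinite_finite_induct)
     (auto intro: multilinear_poly_const multilinear_poly_add)

text \<open>Bits are idempotent, so multiplying by a variable turns the monomial of \<open>S\<close>
  into that of \<open>insert j S\<close>.\<close>

lemma multilinear_poly_var_mult:
  assumes "multilinear_poly N d f" and j: "j < N"
  shows "multilinear_poly N (Suc d) (\<lambda>x. of_bool (x ! j) * f x)"
  using assms(1)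
proof (induction rule: multilinear_poly.induct)
  case (monom S d f c)
  show ?case
  proof (rule multilinear_poly.monom[of "insert j S" _ _ _ c])
    show "card (insert j S) \<le> Suc d"
      using monom(2) card_insert_le_m1[of "Suc d" S j] by simp
    show "of_bool (x ! j) * f x = c * of_bool (insert j S \<subseteq> solutions x)" if "length x = N" for x
      using monom(3)[OF that] j that by (auto simp: solutions_def)
  qed (use monom(1) j in auto)
next
  case (add d f g h)
  show ?case by (rule multilinear_poly.add[OF add.IH]) (simp add: add.hyps distrib_left)
qed

text \<open>A choice by a bit is affine in that bit. The entries of the query gate and the factors
  \<open>1 - x j\<close> of the error polynomial both have this form.\<close>

lemma multilinear_poly_affine_mult:
  assumes "multilinear_poly N d f" and "j < N"
  shows "multilinear_poly N (Suc d) (\<lambda>x. (if x ! j then a else b) * f x)"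
proof (rule multilinear_poly.add)
  show "multilinear_poly N (Suc d) (\<lambda>x. b * f x)"
    by (rule multilinear_poly_cmult[OF multilinear_poly_mono[OF assms(1)]]) simp
  show "multilinear_poly N (Suc d) (\<lambda>x. (a - b) * (of_bool (x ! j) * f x))"
    by (rule multilinear_poly_cmult[OF multilinear_poly_var_mult[OF assms]])
qed (simp add: algebra_simps)

section \<open>Averaging over inputs of equal Hamming weight\<close>

definition inputs_of_weight :: "nat \<Rightarrow> nat \<Rightarrow> bool list set" where
  "inputs_of_weight N k = {x. length x = N \<and> card (solutions x) = k}"

lemma finite_inputs_of_weight: "finite (inputs_of_weight N k)"
  by (rule finite_subset[OF _ finite_promise_inputs[of N 0]])
     (auto simp: inputs_of_weight_def promise_inputs_def)

lemma bij_betw_solutions: "bij_betw solutions {x. length x = N} (Pow {..<N})"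
proof (rule bij_betwI[where g = "\<lambda>X. map (\<lambda>j. j \<in> X) [0..<N]"])
  show "solutions \<in> {x. length x = N} \<rightarrow> Pow {..<N}" by (auto simp: solutions_def)
qed (auto simp: solutions_def intro!: nth_equalityI)

lemma card_inputs_containing:
  assumes S: "S \<subseteq> {..<N}" and k: "card S \<le> k"
  shows "card {x \<in> inputs_of_weight N k. S \<subseteq> solutions x} = (N - card S choose (k - card S))"
proof -
  have finS: "finite S" using S finite_subset by blast
  have "bij_betw solutions {x \<in> inputs_of_weight N k. S \<subseteq> solutions x}
      {X. X \<subseteq> {..<N} \<and> card X = k \<and> S \<subseteq> X}"
  proof (rule bij_betw_subset[OF bij_betw_solutions[of N]])
    show "solutions ` {x \<in> inputs_of_weight N k. S \<subseteq> solutions x} =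
        {X. X \<subseteq> {..<N} \<and> card X = k \<and> S \<subseteq> X}"
    proof (intro equalityI subsetI)
      fix X assume X: "X \<in> {X. X \<subseteq> {..<N} \<and> card X = k \<and> S \<subseteq> X}"
      then have "X \<in> solutions ` {x. length x = N}"
        using bij_betw_imp_surj_on[OF bij_betw_solutions[of N]] by simp
      then show "X \<in> solutions ` {x \<in> inputs_of_weight N k. S \<subseteq> solutions x}"
        using X by (auto simp: inputs_of_weight_def)
    qed (auto simp: inputs_of_weight_def solutions_def)
  qed (auto simp: inputs_of_weight_def)
  then have "card {x \<in> inputs_of_weight N k. S \<subseteq> solutions x} =
      card {X. X \<subseteq> {..<N} \<and> card X = k \<and> S \<subseteq> X}" by (rule bij_betw_same_card)
  also have "\<dots> = card {Y. Y \<subseteq> {..<N} - S \<and> card Y = k - card S}"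
  proof (rule bij_betw_same_card, rule bij_betwI[where g = "\<lambda>Y. Y \<union> S"])
    show "(\<lambda>X. X - S) \<in> {X. X \<subseteq> {..<N} \<and> card X = k \<and> S \<subseteq> X} \<rightarrow>
        {Y. Y \<subseteq> {..<N} - S \<and> card Y = k - card S}"
      using finS by (auto simp: card_Diff_subset)
    show "(\<lambda>Y. Y \<union> S) \<in> {Y. Y \<subseteq> {..<N} - S \<and> card Y = k - card S} \<rightarrow>
        {X. X \<subseteq> {..<N} \<and> card X = k \<and> S \<subseteq> X}"
    proof (intro Pi_I CollectI conjI)
      fix Y assume "Y \<in> {Y. Y \<subseteq> {..<N} - S \<and> card Y = k - card S}"
      then have Y: "Y \<subseteq> {..<N} - S" "card Y = k - card S" by auto
      then have "finite Y" using finite_subset by blast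
      then show "card (Y \<union> S) = k" using Y k finS by (subst card_Un_disjoint) auto
      show "Y \<union> S \<subseteq> {..<N}" using Y S by auto
    qed auto
  qed auto
  also have "\<dots> = (card ({..<N} - S) choose (k - card S))" by (rule n_subsets) simp
  also have "card ({..<N} - S) = N - card S" using S finS by (simp add: card_Diff_subset)
  finally show ?thesis .
qed

definition binomial_poly :: "nat \<Rightarrow> real poly" where
  "binomial_poly s = Polynomial.smult (1 / fact s) (\<Prod>i<s. [:- real i, 1:])"

lemma poly_binomial_poly: "poly (binomial_poly s) (real k) = real (k choose s)"
  by (simp add: binomial_poly_def poly_prod binomial_gbinomial gbinomial_prod_rev atLeast0LessThan)

lemma degree_binomial_poly: "degree (binomial_poly s) \<le> s"
  unfolding binomial_poly_def
  by (rule order_trans[OF degree_smult_le], rule order_trans[OF degree_prod_sum_le])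
     (simp_all add: o_def)

text \<open>The monomial of a set of size \<open>s\<close> has average
  \<open>(k choose s) / (N choose s)\<close> over the inputs of weight \<open>k\<close>, a
  polynomial of degree \<open>s\<close> in \<open>k\<close>. Sums follow by linearity; the average
  is stated with its denominator cleared.\<close>

lemma symmetrization:
  assumes "multilinear_poly N d f"
  shows "\<exists>q :: real poly. degree q \<le> d \<and>
    (\<forall>k\<le>N. poly q (real k) * real (N choose k) = (\<Sum>x\<in>inputs_of_weight N k. Re (f x)))"
  using assms
proof (induction rule: multilinear_poly.induct)
  case (monom S d f c)
  let ?s = "card S"
  have sN: "?s \<le> N" using card_mono[OF _ monom(1)] by simp
  define q where "q = Polynomial.smult (Re c / real (N choose ?s)) (binomial_poly ?s)"
  show ?case
  proof (intro exI[of _ q] conjI allI impI)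
    show "degree q \<le> d"
      unfolding q_def using order_trans[OF degree_smult_le degree_binomial_poly] monom(2)
      by (rule order_trans)
    fix k assume k: "k \<le> N"
    have "(\<Sum>x\<in>inputs_of_weight N k. Re (f x)) =
        (\<Sum>x\<in>inputs_of_weight N k. if S \<subseteq> solutions x then Re c else 0)"
      using monom(3) by (intro sum.cong) (auto simp: inputs_of_weight_def)
    also have "\<dots> = Re c * real (card {x \<in> inputs_of_weight N k. S \<subseteq> solutions x})"
      using finite_inputs_of_weight by (simp add: sum.If_cases Int_def)
    also have "\<dots> = poly q (real k) * real (N choose k)"
    proof (cases "?s \<le> k")
      case True
      have "(N choose k) * (k choose ?s) = (N choose ?s) * (N - ?s choose (k - ?s))"
        by (rule choose_mult[OF True k])
      then have "real (N choose k) * real (k choose ?s) =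
          real (N choose ?s) * real (N - ?s choose (k - ?s))"
        by (metis of_nat_mult)
      moreover have "real (N choose ?s) > 0" using sN by simp
      ultimately have "real (N - ?s choose (k - ?s)) =
          real (N choose k) * real (k choose ?s) / real (N choose ?s)"
        by (simp add: field_simps)
      then show ?thesis
        unfolding card_inputs_containing[OF monom(1) True]
        by (simp add: q_def poly_binomial_poly)
    next
      \<comment> \<open>Below \<open>card S\<close> no input contains \<open>S\<close>, and the
        binomial polynomial vanishes too.\<close>
      case False
      have "?s \<le> card (solutions x)" if "S \<subseteq> solutions x" for x
        by (rule card_mono[OF _ that]) (simp add: solutions_def)
      then have empty: "{x \<in> inputs_of_weight N k. S \<subseteq> solutions x} = {}"
        using False by (auto simp: inputs_of_weight_def)
      show ?thesis unfolding empty using False by (simp add: q_def poly_binomial_poly binomial_eq_0)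
    qed
    finally show "poly q (real k) * real (N choose k) = (\<Sum>x\<in>inputs_of_weight N k. Re (f x))" ..
  qed
next
  case (add d f g h)
  then obtain q r :: "real poly" where qr: "degree q \<le> d" "degree r \<le> d"
      "\<And>k. k \<le> N \<Longrightarrow> poly q (real k) * real (N choose k) = (\<Sum>x\<in>inputs_of_weight N k. Re (f x))"
      "\<And>k. k \<le> N \<Longrightarrow> poly r (real k) * real (N choose k) = (\<Sum>x\<in>inputs_of_weight N k. Re (g x))"
    by blast
  show ?case
  proof (intro exI[of _ "q + r"] conjI allI impI)
    show "degree (q + r) \<le> d" using qr by (intro degree_add_le)
    fix k assume "k \<le> N"
    then have "poly (q + r) (real k) * real (N choose k) =
        (\<Sum>x\<in>inputs_of_weight N k. Re (f x)) + (\<Sum>x\<in>inputs_of_weight N k. Re (g x))"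
      using qr(3,4) by (simp add: distrib_right)
    also have "\<dots> = (\<Sum>x\<in>inputs_of_weight N k. Re (h x))"
      unfolding sum.distrib[symmetric]
      by (intro sum.cong) (auto simp: inputs_of_weight_def add.hyps(3))
    finally show "poly (q + r) (real k) * real (N choose k) =
        (\<Sum>x\<in>inputs_of_weight N k. Re (h x))" .
  qed
qed

text \<open>Weight 0 has the zero string as its only input, so the average there is the value
  itself; at other weights an average inherits a common bound.\<close>

lemma symmetrization_bounds:
  assumes "multilinear_poly N d f"
  obtains q :: "real poly" where "degree q \<le> d"
    and "poly q 0 = Re (f (replicate N False))"
    and "\<And>k B. k \<le> N \<Longrightarrow> (\<And>x. length x = N \<Longrightarrow> card (solutions x) = k \<Longrightarrow> norm (f x) \<le> B) \<Longrightarrow>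
      \<bar>poly q (real k)\<bar> \<le> B"
proof -
  obtain q :: "real poly" where q: "degree q \<le> d"
      "\<And>k. k \<le> N \<Longrightarrow> poly q (real k) * real (N choose k) = (\<Sum>x\<in>inputs_of_weight N k. Re (f x))"
    using symmetrization[OF assms] by blast
  have "inputs_of_weight N 0 = {replicate N False}"
    by (auto simp: inputs_of_weight_def solutions_def intro!: nth_equalityI)
  then have "poly q 0 = Re (f (replicate N False))" using q(2)[of 0] by simp
  moreover have "\<bar>poly q (real k)\<bar> \<le> B"
    if k: "k \<le> N" and B: "\<And>x. length x = N \<Longrightarrow> card (solutions x) = k \<Longrightarrow> norm (f x) \<le> B" for k B
  proof -
    have "card (inputs_of_weight N k) = N choose k"
      using card_inputs_containing[of "{}" N k] by simp
    moreover have "\<bar>\<Sum>x\<in>inputs_of_weight N k. Re (f x)\<bar> \<le> real (card (inputs_of_weight N k)) * B"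
      using B by (intro order_trans[OF sum_abs] sum_bounded_above)
        (auto simp: inputs_of_weight_def intro: order_trans[OF abs_Re_le_cmod])
    ultimately have "\<bar>poly q (real k)\<bar> * real (N choose k) \<le> B * real (N choose k)"
      using q(2)[OF k] by (simp add: abs_mult flip: of_nat_mult) (simp add: abs_mult mult.commute)
    moreover have "0 < real (N choose k)" using k by simp
    ultimately show ?thesis by (simp only: mult_le_cancel_right_pos)
  qed
  ultimately show thesis using q(1) that by blast
qed

section \<open>Amplitudes of query algorithms\<close>

text \<open>The quadratic form of \<open>mat_adjoint M * M\<close> is the shape to which the
  completeness relation of a measurement applies.\<close>

lemma norm_sq_mult_mat_vec:
  fixes M :: "complex mat"
  assumes "M \<in> carrier_mat d d" "v \<in> carrier_vec d"
  shows "complex_of_real (norm_sq (M *\<^sub>v v)) =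
    (\<Sum>r<d. \<Sum>k<d. cnj (v $ r) * ((mat_adjoint M * M) $$ (r, k)) * v $ k)"
proof -
  have adj: "mat_adjoint M \<in> carrier_mat d d" using assms by (auto simp: mat_adjoint_def)
  have entry: "(mat_adjoint M * M) $$ (r, k) = (\<Sum>i<d. cnj (M $$ (i, r)) * M $$ (i, k))"
    if "r < d" "k < d" for r k
    using that assms adj mat_adjoint_index[OF assms(1)]
    by (simp add: scalar_prod_def atLeast0LessThan)
  have "complex_of_real (norm_sq (M *\<^sub>v v)) = (\<Sum>i<d. cnj ((M *\<^sub>v v) $ i) * (M *\<^sub>v v) $ i)"
    using assms unfolding norm_sq_def of_real_sum
    by (intro sum.cong) (auto simp: complex_norm_square mult.commute simp del: of_real_power)
  also have "\<dots> = (\<Sum>i<d. (\<Sum>r<d. cnj (M $$ (i, r) * v $ r)) * (\<Sum>k<d. M $$ (i, k) * v $ k))"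
    using assms by (intro sum.cong) (auto simp: scalar_prod_def atLeast0LessThan cnj_sum)
  also have "\<dots> = (\<Sum>i<d. \<Sum>r<d. \<Sum>k<d. cnj (v $ r) * (cnj (M $$ (i, r)) * M $$ (i, k)) * v $ k)"
    unfolding sum_product by (intro sum.cong refl) (simp add: mult_ac)
  also have "\<dots> = (\<Sum>r<d. \<Sum>i<d. \<Sum>k<d. cnj (v $ r) * (cnj (M $$ (i, r)) * M $$ (i, k)) * v $ k)"
    by (rule sum.swap)
  also have "\<dots> = (\<Sum>r<d. \<Sum>k<d. \<Sum>i<d. cnj (v $ r) * (cnj (M $$ (i, r)) * M $$ (i, k)) * v $ k)"
    by (intro sum.cong refl sum.swap)
  also have "\<dots> = (\<Sum>r<d. \<Sum>k<d. cnj (v $ r) * ((mat_adjoint M * M) $$ (r, k)) * v $ k)"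
    by (intro sum.cong) (auto simp: entry sum_distrib_left sum_distrib_right)
  finally show ?thesis .
qed

lemma quantum_measurement_norm_sq:
  assumes M: "quantum_measurement d N M" and v: "v \<in> carrier_vec d"
  shows "(\<Sum>j<N. norm_sq (M j *\<^sub>v v)) = norm_sq v"
proof -
  have carrier: "M j \<in> carrier_mat d d" if "j < N" for j
    using M that by (simp add: quantum_measurement_def)
  have complete: "(\<Sum>j<N. (mat_adjoint (M j) * M j) $$ (r, k)) = (if r = k then 1 else 0)"
    if "r < d" "k < d" for r k
  proof -
    have "mat d d (\<lambda>rk. \<Sum>j<N. (mat_adjoint (M j) * M j) $$ rk) $$ (r, k) = 1\<^sub>m d $$ (r, k)"
      using M by (simp add: quantum_measurement_def)
    then show ?thesis using that by simp
  qed
  have "complex_of_real (\<Sum>j<N. norm_sq (M j *\<^sub>v v)) =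
      (\<Sum>j<N. \<Sum>r<d. \<Sum>k<d. cnj (v $ r) * ((mat_adjoint (M j) * M j) $$ (r, k)) * v $ k)"
    unfolding of_real_sum using norm_sq_mult_mat_vec[OF carrier v] by (intro sum.cong) auto
  also have "\<dots> = (\<Sum>r<d. \<Sum>j<N. \<Sum>k<d. cnj (v $ r) * ((mat_adjoint (M j) * M j) $$ (r, k)) * v $ k)"
    by (rule sum.swap)
  also have "\<dots> = (\<Sum>r<d. \<Sum>k<d. \<Sum>j<N. cnj (v $ r) * ((mat_adjoint (M j) * M j) $$ (r, k)) * v $ k)"
    by (intro sum.cong refl sum.swap)
  also have "\<dots> = (\<Sum>r<d. \<Sum>k<d. cnj (v $ r) * (if r = k then 1 else 0) * v $ k)"
    by (intro sum.cong) (auto simp: complete simp flip: sum_distrib_left sum_distrib_right)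
  also have "\<dots> = (\<Sum>r<d. \<Sum>k<d. if r = k then cnj (v $ r) * v $ r else 0)"
    by (intro sum.cong) auto
  also have "\<dots> = (\<Sum>r<d. cnj (v $ r) * v $ r)" by (intro sum.cong) auto
  also have "\<dots> = complex_of_real (norm_sq v)"
    using v unfolding norm_sq_def of_real_sum
    by (intro sum.cong) (auto simp: complex_norm_square mult.commute simp del: of_real_power)
  finally show ?thesis by (simp only: of_real_eq_iff)
qed

text \<open>A unitary is a measurement with a single outcome.\<close>

lemma unitary_norm_sq:
  assumes "unitary_mat d U" "v \<in> carrier_vec d"
  shows "norm_sq (U *\<^sub>v v) = norm_sq v"
proof -
  have "quantum_measurement d 1 (\<lambda>_. U)"
    using assms(1) by (auto simp: quantum_measurement_def unitary_mat_def)
  from quantum_measurement_norm_sq[OF this assms(2)] show ?thesis by simp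
qed

text \<open>With no bit set a query flips nothing, so the zero-input state evolves under the
  unitaries alone.\<close>

lemma query_gate_zero_input: "query_gate N W (replicate N False) = 1\<^sub>m (query_dim N W)"
proof (rule eq_matI)
  fix r k assume "r < dim_row (1\<^sub>m (query_dim N W) :: complex mat)"
    "k < dim_col (1\<^sub>m (query_dim N W) :: complex mat)"
  then have rk: "r < query_dim N W" "k < query_dim N W" by auto
  then have "k div W < N * 2" by (simp add: query_dim_def less_mult_imp_div_less)
  then have "k div W div 2 < N" by (rule less_mult_imp_div_less)
  then have "query_map W (replicate N False) k = k"
    by (simp add: query_map_def basis_index_def)
  then show "query_gate N W (replicate N False) $$ (r, k) = 1\<^sub>m (query_dim N W) $$ (r, k)"
    using rk by (simp add: query_gate_def)
qed (auto simp: query_gate_def)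

lemma query_gate_carrier: "query_gate N W x \<in> carrier_mat (query_dim N W) (query_dim N W)"
  by (simp add: query_gate_def)

lemma query_state_carrier:
  assumes "search_algorithm N T A" "i \<le> T"
  shows "query_state N A x i \<in> carrier_vec (query_dim N (workspace A))"
  using assms(2)
proof (induction i)
  case 0
  then show ?case using assms(1) by (auto simp: search_algorithm_def unitary_mat_def)
next
  case (Suc i)
  then have "gate A (Suc i) \<in> carrier_mat (query_dim N (workspace A)) (query_dim N (workspace A))"
    using assms(1) by (auto simp: search_algorithm_def unitary_mat_def)
  then show ?case using Suc query_gate_carrier[of N "workspace A" x]
    by (auto intro!: mult_mat_vec_carrier)
qed

lemma norm_sq_query_state_zero_input:
  assumes A: "search_algorithm N T A" and N: "0 < N" and i: "i \<le> T"
  shows "norm_sq (query_state N A (replicate N False) i) = 1"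
  using i
proof (induction i)
  case 0
  let ?d = "query_dim N (workspace A)"
  have d: "0 < ?d" using A N by (simp add: search_algorithm_def query_dim_def)
  have "norm_sq (unit_vec ?d 0) = (\<Sum>i<?d. if i = 0 then 1 else 0)"
    unfolding norm_sq_def by (intro sum.cong) auto
  then have "norm_sq (unit_vec ?d 0) = 1" using d by simp
  then show ?case
    using A unitary_norm_sq[of ?d "gate A 0" "unit_vec ?d 0"] by (simp add: search_algorithm_def)
next
  case (Suc i)
  then show ?case
    using A unitary_norm_sq[of "query_dim N (workspace A)" "gate A (Suc i)" "query_state N A (replicate N False) i"]
      query_state_carrier[OF A, of i "replicate N False"]
    by (simp add: search_algorithm_def query_gate_zero_input)
qed

section \<open>Amplitudes as multilinear polynomials in the input\<close>

lemma multilinear_poly_mult_mat_vec: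
  assumes M: "M \<in> carrier_mat d d" and v: "\<And>x. v x \<in> carrier_vec d"
    and low: "\<And>k. k < d \<Longrightarrow> multilinear_poly N e (\<lambda>x. v x $ k)" and r: "r < d"
  shows "multilinear_poly N e (\<lambda>x. (M *\<^sub>v v x) $ r)"
proof -
  have "(M *\<^sub>v v x) $ r = (\<Sum>k<d. M $$ (r, k) * v x $ k)" for x
    using M v[of x] r by (auto simp: scalar_prod_def atLeast0LessThan)
  then show ?thesis
    by (simp only:) (intro multilinear_poly_sum multilinear_poly_cmult low, simp)
qed

text \<open>Each column of the gate is one of two fixed basis vectors, selected by the queried bit.
  Its entries are affine in one variable, so a query raises the degree by one.\<close>

lemma multilinear_poly_query_gate:
  assumes v: "\<And>x. v x \<in> carrier_vec (query_dim N W)"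
    and low: "\<And>k. k < query_dim N W \<Longrightarrow> multilinear_poly N e (\<lambda>x. v x $ k)"
    and r: "r < query_dim N W"
  shows "multilinear_poly N (Suc e) (\<lambda>x. (query_gate N W x *\<^sub>v v x) $ r)"
proof -
  \<comment> \<open>\<open>flip a k\<close> is the gate entry in row \<open>r\<close> and column
    \<open>k\<close> when the queried bit is \<open>a\<close>.\<close>
  define flip where "flip a k = (if r = basis_index W (k div W div 2) ((k div W mod 2 + a) mod 2) (k mod W)
    then 1 else 0 :: complex)" for a k
  have "(query_gate N W x *\<^sub>v v x) $ r =
      (\<Sum>k<query_dim N W. (if x ! (k div W div 2) then flip 1 k else flip 0 k) * v x $ k)" for x
    using v[of x] r
    by (auto simp: scalar_prod_def atLeast0LessThan query_gate_def query_map_def Let_def flip_def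
      intro!: sum.cong)
  moreover have "k div W div 2 < N" if "k < query_dim N W" for k
  proof -
    have "k div W < N * 2" using that by (simp add: query_dim_def less_mult_imp_div_less)
    then show ?thesis by (rule less_mult_imp_div_less)
  qed
  ultimately show ?thesis
    using low by (auto intro!: multilinear_poly_sum multilinear_poly_affine_mult)
qed

lemma multilinear_poly_query_state:
  assumes A: "search_algorithm N T A" and "i \<le> T" "r < query_dim N (workspace A)"
  shows "multilinear_poly N i (\<lambda>x. query_state N A x i $ r)"
  using assms(2,3)
proof (induction i arbitrary: r)
  case 0
  then show ?case by (simp add: multilinear_poly_const)
next
  case (Suc i)
  have "gate A (Suc i) \<in> carrier_mat (query_dim N (workspace A)) (query_dim N (workspace A))"
    using A Suc.prems by (auto simp: search_algorithm_def unitary_mat_def)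
  moreover have "query_state N A x i \<in> carrier_vec (query_dim N (workspace A))" for x
    using query_state_carrier[OF A] Suc.prems by simp
  ultimately show ?case
    unfolding query_state.simps
    using Suc query_gate_carrier[of N "workspace A"]
    by (intro multilinear_poly_mult_mat_vec multilinear_poly_query_gate) (auto intro!: mult_mat_vec_carrier)
qed

text \<open>The zero-input vectors enter as constant coefficients, so the degree is the
  \<open>T\<close> of the amplitudes plus one for \<open>1 - x j\<close>. On the zero string every
  index is a non-solution, and \<open>g\<close> is the total probability 1. The error on
  \<open>x\<close> is the squared norm of the non-solution components, so Cauchy--Schwarz gives the
  bound.\<close>

lemma ex_error_polynomial:
  assumes A: "search_algorithm N T A" and N: "0 < N"
  obtains g where "multilinear_poly N (Suc T) g" and "g (replicate N False) = 1"
    and "\<And>x. length x = N \<Longrightarrow> norm (g x) \<le> sqrt (input_error N T A x)"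
proof -
  define d where "d = query_dim N (workspace A)"
  define \<psi> where "\<psi> j x = measurement A j *\<^sub>v query_state N A x T" for j x
  define z where "z = replicate N False"
  have meas: "quantum_measurement d N (measurement A)"
    using A by (simp add: search_algorithm_def d_def)
  then have M: "measurement A j \<in> carrier_mat d d" if "j < N" for j
    using that by (simp add: quantum_measurement_def)
  have state: "query_state N A x T \<in> carrier_vec d" for x
    using query_state_carrier[OF A] by (simp add: d_def)
  have dim: "dim_vec (\<psi> j x) = d" if "j < N" for j x using M[OF that] by (simp add: \<psi>_def)
  define g where "g x = (\<Sum>j<N. (if x ! j then 0 else 1) * (\<Sum>r<d. cnj (\<psi> j z $ r) * \<psi> j x $ r))" for x
  have sum1: "(\<Sum>j<N. norm_sq (\<psi> j z)) = 1"
    using quantum_measurement_norm_sq[OF meas state, of z]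
      norm_sq_query_state_zero_input[OF A N, of T] by (simp add: \<psi>_def z_def)
  have norm_sq: "norm_sq (\<psi> j x) = (\<Sum>r<d. (norm (\<psi> j x $ r))\<^sup>2)" if "j < N" for j x
    using dim[OF that] by (simp add: norm_sq_def)
  show thesis
  proof (rule that[of g])
    have "multilinear_poly N T (\<lambda>x. \<psi> j x $ r)" if "j < N" "r < d" for j r
      unfolding \<psi>_def using that M state multilinear_poly_query_state[OF A]
      by (intro multilinear_poly_mult_mat_vec[of _ d]) (auto simp: d_def)
    then show "multilinear_poly N (Suc T) g"
      unfolding g_def
      by (intro multilinear_poly_sum multilinear_poly_affine_mult multilinear_poly_cmult) auto
    have "g z = (\<Sum>j<N. complex_of_real (norm_sq (\<psi> j z)))"
      unfolding g_def
    proof (intro sum.cong refl)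
      fix j assume "j \<in> {..<N}"
      then have j: "j < N" by simp
      have "(\<Sum>r<d. cnj (\<psi> j z $ r) * \<psi> j z $ r) = complex_of_real (norm_sq (\<psi> j z))"
        unfolding norm_sq[OF j] of_real_sum
        by (intro sum.cong) (auto simp: complex_norm_square mult.commute simp del: of_real_power)
      then show "(if z ! j then 0 else 1) * (\<Sum>r<d. cnj (\<psi> j z $ r) * \<psi> j z $ r) =
          complex_of_real (norm_sq (\<psi> j z))"
        using j by (simp add: z_def)
    qed
    then show "g (replicate N False) = 1"
      using sum1 by (simp add: z_def flip: of_real_sum)
    fix x :: "bool list" assume x: "length x = N"
    define J where "J = {..<N} - solutions x"
    have J: "J = {j \<in> {..<N}. \<not> x ! j}" using x by (auto simp: J_def solutions_def)
    \<comment> \<open>Pairs of outcome and coordinate form one index set, so a single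
      Cauchy--Schwarz step serves all outcomes.\<close>
    have L2: "L2_set (\<lambda>(j, r). norm (\<psi> j y $ r)) (J \<times> {..<d}) = sqrt (\<Sum>j\<in>J. norm_sq (\<psi> j y))" for y
    proof -
      have "(\<Sum>j\<in>J. norm_sq (\<psi> j y)) = (\<Sum>j\<in>J. \<Sum>r<d. (norm (\<psi> j y $ r))\<^sup>2)"
        by (intro sum.cong) (auto simp: norm_sq J)
      then show ?thesis
        by (simp add: L2_set_def sum.cartesian_product case_prod_unfold)
    qed
    have "(\<Sum>j\<in>J. norm_sq (\<psi> j z)) \<le> (\<Sum>j<N. norm_sq (\<psi> j z))"
      by (rule sum_mono2) (auto simp: J norm_sq_def sum_nonneg)
    then have le1: "sqrt (\<Sum>j\<in>J. norm_sq (\<psi> j z)) \<le> 1" by (simp add: sum1)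
    have "g x = (\<Sum>j<N. if \<not> x ! j then \<Sum>r<d. cnj (\<psi> j z $ r) * \<psi> j x $ r else 0)"
      unfolding g_def by (intro sum.cong) auto
    also have "\<dots> = (\<Sum>j\<in>J. \<Sum>r<d. cnj (\<psi> j z $ r) * \<psi> j x $ r)"
      unfolding J by (rule sum.inter_filter[symmetric]) simp
    also have "\<dots> = (\<Sum>(j, r)\<in>J \<times> {..<d}. cnj (\<psi> j z $ r) * \<psi> j x $ r)"
      by (rule sum.cartesian_product)
    also have "norm \<dots> \<le> (\<Sum>(j, r)\<in>J \<times> {..<d}. \<bar>norm (\<psi> j z $ r)\<bar> * \<bar>norm (\<psi> j x $ r)\<bar>)"
      by (rule order_trans[OF norm_sum]) (auto intro!: sum_mono simp: norm_mult)
    also have "\<dots> \<le> L2_set (\<lambda>(j, r). norm (\<psi> j z $ r)) (J \<times> {..<d}) *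
        L2_set (\<lambda>(j, r). norm (\<psi> j x $ r)) (J \<times> {..<d})"
      using L2_set_mult_ineq[of "\<lambda>(j, r). norm (\<psi> j z $ r)" "\<lambda>(j, r). norm (\<psi> j x $ r)" "J \<times> {..<d}"]
      by (simp add: case_prod_unfold)
    also have "\<dots> \<le> 1 * sqrt (\<Sum>j\<in>J. norm_sq (\<psi> j x))"
      unfolding L2 by (intro mult_right_mono le1) (simp add: norm_sq_def sum_nonneg)
    finally show "norm (g x) \<le> sqrt (input_error N T A x)"
      by (simp add: input_error_def output_prob_def \<psi>_def J_def)
  qed
qed

section \<open>The lower bound\<close>

text \<open>This permits doubling \<open>b\<close> in the final bound, where \<open>T + 1\<close> is
  replaced by \<open>2 * T\<close>.\<close>

lemma coppersmith_rivlin_mono: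
  assumes "coppersmith_rivlin a b" "b \<le> b'"
  shows "coppersmith_rivlin a b'"
  unfolding coppersmith_rivlin_def
proof (intro conjI allI impI)
  fix p :: "real poly" and n :: nat and x :: real
  assume "0 < n \<and> degree p \<le> n \<and> (\<forall>i\<le>n. \<bar>poly p (real i)\<bar> \<le> 1)" and "0 \<le> x \<and> x \<le> real n"
  then have "\<bar>poly p x\<bar> < a * exp (b * (real (degree p))\<^sup>2 / real n)"
    using assms(1) unfolding coppersmith_rivlin_def by blast
  also have "\<dots> \<le> a * exp (b' * (real (degree p))\<^sup>2 / real n)"
    using assms by (auto simp: coppersmith_rivlin_def intro!: divide_right_mono mult_right_mono)
  finally show "\<bar>poly p x\<bar> < a * exp (b' * (real (degree p))\<^sup>2 / real n)" .
qed (use assms in \<open>auto simp: coppersmith_rivlin_def\<close>)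

text \<open>Shifting by \<open>t\<close> and dividing by \<open>\<delta>\<close> gives a polynomial
  to which the inequality applies on [0, n]. Rescaled to [-1, 1], the old origin becomes
  \<open>- 1 - 2 * t / n\<close>, so \<open>poly_extrapolate\<close> is used with
  \<open>\<mu> = 2 * t / n\<close>.\<close>

lemma coppersmith_rivlin_extrapolate:
  fixes q :: "real poly"
  assumes cr: "coppersmith_rivlin a b" and n: "0 < n" and deg: "degree q \<le> d" "d \<le> n"
    and \<delta>: "0 < \<delta>" and bd: "\<And>i. i \<le> n \<Longrightarrow> \<bar>poly q (real (t + i))\<bar> \<le> \<delta>"
  shows "\<bar>poly q 0\<bar> \<le> \<delta> * (a * exp (b * (real d)\<^sup>2 / real n) * exp (2 * real d * sqrt (real t / real n)))"
proof -
  define p where "p = Polynomial.smult (1 / \<delta>) (q \<circ>\<^sub>p [:real t, 1:])"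
  have p: "poly p y = poly q (real t + y) / \<delta>" for y by (simp add: p_def poly_pcompose)
  have degp: "degree p \<le> d" using deg by (simp add: p_def)
  define B where "B = a * exp (b * (real d)\<^sup>2 / real n)"
  have ab: "0 < a" "0 < b" using cr by (auto simp: coppersmith_rivlin_def)
  have B: "\<bar>poly p y\<bar> \<le> B" if "0 \<le> y" "y \<le> real n" for y
  proof -
    have "\<bar>poly p y\<bar> < a * exp (b * (real (degree p))\<^sup>2 / real n)"
    proof -
      have "\<bar>poly p (real i)\<bar> \<le> 1" if "i \<le> n" for i
        using bd[OF that] \<delta> by (simp add: p)
      then show ?thesis
        using cr n degp deg(2) that unfolding coppersmith_rivlin_def by auto
    qed
    also have "\<dots> \<le> B"
      unfolding B_def using ab degp by (auto intro!: divide_right_mono mult_left_mono power_mono)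
    finally show ?thesis by simp
  qed
  define P where "P = p \<circ>\<^sub>p [:real n / 2, real n / 2:]"
  have P: "poly P y = poly p (real n * (1 + y) / 2)" for y
    by (simp add: P_def poly_pcompose field_simps)
  have "\<bar>poly P (- 1 - 2 * real t / real n)\<bar> \<le> B * exp (real d * sqrt (2 * (2 * real t / real n)))"
  proof (rule poly_extrapolate)
    show "degree P \<le> d" using degp by (simp add: P_def)
    show "\<bar>poly P x\<bar> \<le> B" if "\<bar>x\<bar> \<le> 1" for x
    proof -
      have "real n * (1 + x) \<le> real n * 2" using that by (intro mult_left_mono) auto
      then show ?thesis unfolding P using that by (intro B) auto
    qed
    have "0 \<le> 2 * real t / real n" by simp
    then show "\<bar>- 1 - 2 * real t / real n\<bar> \<le> 1 + 2 * real t / real n" by linarith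
  qed simp
  also have "sqrt (2 * (2 * real t / real n)) = 2 * sqrt (real t / real n)"
    by (simp add: real_sqrt_mult[symmetric] real_sqrt_divide) (simp add: real_sqrt_mult)
  also have "poly P (- 1 - 2 * real t / real n) = poly q 0 / \<delta>"
    using n by (simp add: P p)
  finally show ?thesis using \<delta> by (simp add: B_def field_simps)
qed

theorem theorem2:
  shows "\<exists>a b. coppersmith_rivlin a b \<and>
    (\<exists>c>0. \<forall>N t T A.
       1 \<le> t \<and> t < N \<and> 1 \<le> T \<and> T < N - t \<and> search_algorithm N T A \<longrightarrow>
       error_prob N t T A \<ge>
         c * exp (- (4 * b * (real T)\<^sup>2 / (real N - real t))
                  - 8 * real T * sqrt (real t * real N / (real N - real t)\<^sup>2)))"
proof -
  obtain a b where cr: "coppersmith_rivlin a b" using ex_coppersmith_rivlin by blast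
  then have ab: "0 < a" "0 < b" by (auto simp: coppersmith_rivlin_def)
  \<comment> \<open>Squaring the bound on \<open>sqrt \<epsilon>\<close> gives the constant
    \<open>1 / a\<^sup>2\<close> and the exponent \<open>2 * F\<close>. As \<open>T + 1\<close>
    \<le> \<open>2 * T\<close>, the first term of \<open>2 * F\<close> is at most
    \<open>8 * b * T\<^sup>2 / n\<close>, hence the \<open>2 * b\<close>.\<close>
  have "error_prob N t T A \<ge>
         1 / a\<^sup>2 * exp (- (4 * (2 * b) * (real T)\<^sup>2 / (real N - real t))
                  - 8 * real T * sqrt (real t * real N / (real N - real t)\<^sup>2))"
    if t: "1 \<le> t" "t < N" and T: "1 \<le> T" "T < N - t" and A: "search_algorithm N T A" for N t T A
  proof -
    define n where "n = N - t"
    have n: "0 < n" "real N - real t = real n" "n \<le> N" using t by (auto simp: n_def of_nat_diff)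
    define \<epsilon> where "\<epsilon> = error_prob N t T A"
    have err: "input_error N T A x \<le> \<epsilon>" if "x \<in> promise_inputs N t" for x
      unfolding \<epsilon>_def error_prob_def using that finite_promise_inputs by (intro Max_ge) auto
    have "solutions (replicate N True) = {..<N}" by (auto simp: solutions_def)
    then have all: "replicate N True \<in> promise_inputs N t" using t by (simp add: promise_inputs_def)
    have "0 \<le> input_error N T A (replicate N True)"
      by (auto simp: input_error_def output_prob_def norm_sq_def intro!: sum_nonneg)
    also have "\<dots> \<le> \<epsilon>"
      by (rule err[OF all])
    finally have \<epsilon>0: "0 \<le> \<epsilon>" .
    obtain g where g: "multilinear_poly N (Suc T) g" "g (replicate N False) = 1"
        "\<And>x. length x = N \<Longrightarrow> norm (g x) \<le> sqrt (input_error N T A x)"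
      using ex_error_polynomial[OF A] t by auto
    obtain q :: "real poly" where q: "degree q \<le> Suc T" "poly q 0 = 1"
        "\<And>k B. k \<le> N \<Longrightarrow> (\<And>x. length x = N \<Longrightarrow> card (solutions x) = k \<Longrightarrow> norm (g x) \<le> B) \<Longrightarrow>
          \<bar>poly q (real k)\<bar> \<le> B"
      using symmetrization_bounds[OF g(1)] g(2) by (metis one_complex.simps(1))
    have qi: "\<bar>poly q (real (t + i))\<bar> \<le> sqrt \<epsilon>" if "i \<le> n" for i
    proof (rule q(3))
      show "t + i \<le> N" using that t by (simp add: n_def)
      fix x :: "bool list" assume "length x = N" "card (solutions x) = t + i"
      then show "norm (g x) \<le> sqrt \<epsilon>"
        using g(3)[of x] err[of x] by (force simp: promise_inputs_def intro: order_trans)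
    qed
    define F where "F = b * (real (Suc T))\<^sup>2 / real n + 2 * real (Suc T) * sqrt (real t / real n)"
    have "1 / (a * exp F) \<le> sqrt \<epsilon>"
    \<comment> \<open>The extrapolation divides by its bound, and \<open>sqrt \<epsilon>\<close> may
      be 0; hence it is run for every larger \<open>\<delta>\<close>.\<close>
    proof (rule dense_ge)
      fix \<delta> assume \<delta>: "sqrt \<epsilon> < \<delta>"
      have "0 < \<delta>" using \<epsilon>0 \<delta> by (meson le_less_trans real_sqrt_ge_zero)
      \<comment> \<open>\<open>T\<close> < \<open>N - t\<close> enters here: the degree bound
        \<open>T + 1\<close> must not exceed \<open>n\<close>.\<close>
      have "\<bar>poly q 0\<bar> \<le> \<delta> * (a * exp (b * (real (Suc T))\<^sup>2 / real n) *
          exp (2 * real (Suc T) * sqrt (real t / real n)))"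
        by (rule coppersmith_rivlin_extrapolate[OF cr n(1) q(1) _ \<open>0 < \<delta>\<close>])
           (use T qi \<delta> in \<open>force simp: n_def\<close>)+
      then have "1 \<le> \<delta> * (a * exp F)" using q(2) by (simp add: F_def exp_add mult.assoc)
      then show "1 / (a * exp F) \<le> \<delta>" using ab by (simp add: field_simps)
    qed
    then have "(1 / (a * exp F))\<^sup>2 \<le> (sqrt \<epsilon>)\<^sup>2" using ab by (intro power_mono) auto
    moreover have "exp (- 2 * F) = 1 / (exp F)\<^sup>2" by (simp add: exp_minus exp_double divide_inverse)
    ultimately have main: "1 / a\<^sup>2 * exp (- 2 * F) \<le> \<epsilon>"
      using \<epsilon>0 by (simp add: power_divide power_mult_distrib)
    have T2: "real (Suc T) \<le> 2 * real T" using T by simp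
    have "(real (Suc T))\<^sup>2 \<le> (2 * real T)\<^sup>2" using T2 by (intro power_mono) auto
    then have "b * (real (Suc T))\<^sup>2 / real n \<le> b * (2 * real T)\<^sup>2 / real n"
      using ab by (intro divide_right_mono mult_left_mono) auto
    moreover have "2 * real (Suc T) * sqrt (real t / real n) \<le>
        2 * (2 * real T) * sqrt (real t * real N / (real n)\<^sup>2)"
    proof (intro mult_mono)
      have "real t / real n = real t * real n / (real n)\<^sup>2" using n by (simp add: power2_eq_square)
      also have "\<dots> \<le> real t * real N / (real n)\<^sup>2" using n by (intro divide_right_mono mult_left_mono) auto
      finally show "sqrt (real t / real n) \<le> sqrt (real t * real N / (real n)\<^sup>2)" by simp
    qed (use T2 in auto)
    ultimately have "2 * F \<le> 4 * (2 * b) * (real T)\<^sup>2 / real n + 8 * real T * sqrt (real t * real N / (real n)\<^sup>2)"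
      by (simp add: F_def power_mult_distrib)
    then have "1 / a\<^sup>2 * exp (- (4 * (2 * b) * (real T)\<^sup>2 / real n) -
        8 * real T * sqrt (real t * real N / (real n)\<^sup>2)) \<le> 1 / a\<^sup>2 * exp (- 2 * F)"
      by (intro mult_left_mono) auto
    with main show ?thesis unfolding \<epsilon>_def n(2) by linarith
  qed
  moreover have "coppersmith_rivlin a (2 * b)" by (rule coppersmith_rivlin_mono[OF cr]) (use ab in simp)
  moreover have "0 < 1 / a\<^sup>2" using ab by simp
  ultimately show ?thesis by blast
qed

end
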